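(* Let $n,p\ge 1$, $q=n+p$, $\tau\in[0,1]$ and $c>0$. Let $z=[x^T\; y^T]^T$ with $x\in\mathbb{R}^n$, $y\in\mathbb{R}^p$, and let the nominal density $f$ of $z$ be Gaussian with mean $m_z=[m_x^T\; m_y^T]^T$ and positive definite covariance $K_z=\begin{bmatrix}K_x & K_{xy}\\ K_{yx} & K_y\end{bmatrix}$. Let $\mathcal{B}_\tau=\{\tilde f \text{ Gaussian density on } \mathbb{R}^{q} \text{ with positive definite covariance}: \mathcal{D}_\tau(\tilde f\|f)\le c\}$, let $J(\tilde f,g)=\mathbb{E}_{\tilde f}[\|x-g(y)\|^2]$, and let $\mathcal{G}$ be the set of estimators $g:\mathbb{R}^p\to\mathbb{R}^n$ such that $\mathbb{E}_{\tilde f}[\|g(y)\|^2]<\infty$ for every $\tilde f\in\mathcal{B}_\tau$. Consider the minimax problem $\min_{g\in\mathcal{G}}\max_{\tilde f\in\mathcal{B}_\tau} J(\tilde f,g)$. Then the optimal robust estimator (solution of this minimax problem) is the Bayes estimator based on $f$, $$g^\circ(y)=G^\circ(y-m_y)+m_x,\qquad G^\circ=K_{xy}K_y^{-1}.$$ The least favorable density $\tilde f^\circ\in\mathcal{B}_\tau$ is Gaussian with mean $\tilde m_z^\circ=m_z$ and covariance $$\tilde K_z^\circ=\begin{bmatrix}\tilde K_x & K_{xy}\\ K_{yx} & K_y\end{bmatrix},$$ i.e. only the covariance of $x$ is perturbed with respect to the nominal covariance. The estimation error $x-g^\circ(y)$ has zero mean under both $f$ and $\tilde f^\circ$, with covariance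 under $f$ and under $\tilde f^\circ$ respectively $$P=K_x-K_{xy}K_y^{-1}K_{yx},\qquad \tilde P=\tilde K_x-K_{xy}K_y^{-1}K_{yx}.$$ Moreover, writing $P=L_PL_P^T$, $$\tilde P=\begin{cases} L_P\left(I_n-\frac{1-\tau}{\lambda}L_P^TL_P\right)^{\frac{1}{\tau-1}}L_P^T, & 0\le\tau<1,\\ L_P\exp\left(\frac{1}{\lambda}L_P^TL_P\right)L_P^T, & \tau=1,\end{cases}$$ where $\lambda>(1-\tau)\|P\|$ is the unique Lagrange multiplier such that $\mathcal{D}_\tau(\tilde f^\circ\|f)=c$.
   Context: For $v\in\mathbb{R}^q$ and a symmetric matrix $A$, $\|v\|_A^2=v^TAv$; $\|P\|$ is the spectral norm (largest singular value); for a positive definite matrix, $\log$ and real powers are the matrix logarithm and matrix power. For Gaussian densities $\tilde f$ (mean $\tilde m_z$, covariance $\tilde K_z\succ0$) and $f$ (mean $m_z$, covariance $K_z\succ 0$) on $\mathbb{R}^q$, let $\Delta m_z=\tilde m_z-m_z$, let $L_z$ be any matrix with $K_z=L_zL_z^T$ and $M=L_z^{-1}\tilde K_zL_z^{-T}$. The $\tau$ divergence is $\mathcal{D}_\tau(\tilde f\|f)=\|\Delta m_z\|^2_{K_z^{-1}}+\mathrm{tr}\left(-\log(\tilde K_zK_z^{-1})+\tilde K_zK_z^{-1}-I_q\right)$ for $\tau=0$; $\mathcal{D}_\tau(\tilde f\|f)=\frac{1}{1-\tau}\|\Delta m_z\|^2_{K_z^{-1}}+\mathrm{tr}\left(\frac{1}{\tau(\tau-1)}M^\tau+\frac{1}{1-\tau}\tilde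 K_zK_z^{-1}+\frac1\tau I_q\right)$ for $0<\tau<1$; $\mathcal{D}_\tau(\tilde f\|f)=\delta(\Delta m_z)+\mathrm{tr}\left(M\log M-\tilde K_zK_z^{-1}+I_q\right)$ for $\tau=1$, where $\delta(\Delta m_z)$ equals $0$ if $\Delta m_z=0$ and $+\infty$ otherwise. *)

theory Defs
  imports "HOL-Analysis.Analysis"
begin

definition pos_def :: "real^'n^'n \<Rightarrow> bool" where
  "pos_def K \<longleftrightarrow> transpose K = K \<and> (\<forall>v. v \<noteq> 0 \<longrightarrow> v \<bullet> (K *v v) > 0)"

definition diag_mat :: "real^'n \<Rightarrow> real^'n^'n" where
  "diag_mat d = (\<chi> i j. if i = j then d $ i else 0)"

text \<open>Primary matrix function of a diagonalizable matrix with real eigenvalues: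
  if A = S diag(d) S^-1 then f(A) = S diag(f(d)) S^-1 (independent of the
  diagonalisation). Used for the matrix logarithm, real matrix powers and the
  matrix exponential of the (diagonalizable) matrices occurring below.\<close>
definition mat_fun :: "(real \<Rightarrow> real) \<Rightarrow> real^'n^'n \<Rightarrow> real^'n^'n" where
  "mat_fun f A = (THE F. \<exists>(S::real^'n^'n) d. invertible S \<and> A = S ** diag_mat d ** matrix_inv S
      \<and> F = S ** diag_mat (\<chi> i. f (d $ i)) ** matrix_inv S)"

definition mat_log :: "real^'n^'n \<Rightarrow> real^'n^'n" where
  "mat_log A = mat_fun ln A"

definition mat_pow :: "real^'n^'n \<Rightarrow> real \<Rightarrow> real^'n^'n" where
  "mat_pow A t = mat_fun (\<lambda>x. x powr t) A"

definition mat_exp :: "real^'n^'n \<Rightarrow> real^'n^'n" where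
  "mat_exp A = mat_fun exp A"

definition spec_norm :: "real^'n^'m \<Rightarrow> real" where
  "spec_norm A = onorm (\<lambda>v. A *v v)"

definition wnorm2 :: "real^'n \<Rightarrow> real^'n^'n \<Rightarrow> real" where
  "wnorm2 v A = v \<bullet> (A *v v)"

definition xpart :: "real^('n::finite + 'p::finite) \<Rightarrow> real^'n" where
  "xpart z = (\<chi> i. z $ Inl i)"

definition ypart :: "real^('n::finite + 'p::finite) \<Rightarrow> real^'p" where
  "ypart z = (\<chi> j. z $ Inr j)"

definition blk_xx :: "real^('n::finite + 'p::finite)^('n + 'p) \<Rightarrow> real^'n^'n" where
  "blk_xx K = (\<chi> i j. K $ Inl i $ Inl j)"

definition blk_xy :: "real^('n::finite + 'p::finite)^('n + 'p) \<Rightarrow> real^'p^'n" where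
  "blk_xy K = (\<chi> i j. K $ Inl i $ Inr j)"

definition blk_yx :: "real^('n::finite + 'p::finite)^('n + 'p) \<Rightarrow> real^'n^'p" where
  "blk_yx K = (\<chi> i j. K $ Inr i $ Inl j)"

definition blk_yy :: "real^('n::finite + 'p::finite)^('n + 'p) \<Rightarrow> real^'p^'p" where
  "blk_yy K = (\<chi> i j. K $ Inr i $ Inr j)"

definition replace_xx :: "real^'n^'n \<Rightarrow> real^('n::finite + 'p::finite)^('n + 'p) \<Rightarrow> real^('n + 'p)^('n + 'p)" where
  "replace_xx Kx K = (\<chi> a b. case (a, b) of (Inl i, Inl j) \<Rightarrow> Kx $ i $ j | _ \<Rightarrow> K $ a $ b)"

definition gauss_pdf :: "real^'q \<Rightarrow> real^'q^'q \<Rightarrow> real^'q \<Rightarrow> real" where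
  "gauss_pdf m K z = (2 * pi) powr (- real CARD('q) / 2) * det K powr (-1/2)
     * exp (- (1/2) * ((z - m) \<bullet> (matrix_inv K *v (z - m))))"

definition tau_div :: "real \<Rightarrow> real^'q \<Rightarrow> real^'q^'q \<Rightarrow> real^'q \<Rightarrow> real^'q^'q \<Rightarrow> ereal" where
  "tau_div \<tau> mt Kt m K =
     (let dm = mt - m;
          L = (SOME L. K = L ** transpose L);
          M = matrix_inv L ** Kt ** transpose (matrix_inv L);
          R = Kt ** matrix_inv K
      in if \<tau> = 0 then
           ereal (wnorm2 dm (matrix_inv K) + trace (- mat_log R + R - mat 1))
         else if \<tau> < 1 then
           ereal (1 / (1 - \<tau>) * wnorm2 dm (matrix_inv K)
              + trace ((1 / (\<tau> * (\<tau> - 1))) *\<^sub>R mat_pow M \<tau> + (1 / (1 - \<tau>)) *\<^sub>R R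
                       + (1 / \<tau>) *\<^sub>R mat 1))
         else
           (if dm = 0 then ereal (trace (M ** mat_log M - R + mat 1)) else \<infinity>))"

definition ball_tau :: "real \<Rightarrow> real \<Rightarrow> real^'q \<Rightarrow> real^'q^'q \<Rightarrow> (real^'q \<Rightarrow> real) set" where
  "ball_tau \<tau> c m K = {gauss_pdf mt Kt | mt Kt. pos_def Kt \<and> tau_div \<tau> mt Kt m K \<le> ereal c}"

definition mse :: "(real^('n::finite + 'p::finite) \<Rightarrow> real) \<Rightarrow> (real^'p \<Rightarrow> real^'n) \<Rightarrow> ennreal" where
  "mse f g = (\<integral>\<^sup>+ z. ennreal (f z) * ennreal ((norm (xpart z - g (ypart z)))\<^sup>2) \<partial>lborel)"

definition estimators :: "(real^('n::finite + 'p::finite) \<Rightarrow> real) set \<Rightarrow> (real^'p \<Rightarrow> real^'n) set" where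
  "estimators B = {g. g \<in> borel_measurable borel \<and>
      (\<forall>f\<in>B. (\<integral>\<^sup>+ z. ennreal (f z) * ennreal ((norm (g (ypart z)))\<^sup>2) \<partial>lborel) < \<infinity>)}"

definition outer :: "real^'n \<Rightarrow> real^'n^'n" where
  "outer u = (\<chi> i j. u $ i * u $ j)"

definition Ptilde_formula :: "real \<Rightarrow> real \<Rightarrow> real^'n^'n \<Rightarrow> real^'n^'n" where
  "Ptilde_formula \<tau> lam L =
     (if \<tau> < 1 then L ** mat_pow (mat 1 - ((1 - \<tau>) / lam) *\<^sub>R (transpose L ** L)) (1 / (\<tau> - 1)) ** transpose L
      else L ** mat_exp ((1 / lam) *\<^sub>R (transpose L ** L)) ** transpose L)"

end

theory Submission
  imports Defs "HOL-Probability.Distributions"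
begin

text \<open>Write \<open>K = T T\<^sup>T\<close> with \<open>T\<close> block upper triangular and \<open>P = X X\<^sup>T\<close> for its first diagonal block \<open>X\<close>,
  where \<open>X\<^sup>T X = diag p\<close>. In the coordinates \<open>z = m + T u\<close> the error of the Bayes estimator is \<open>X u\<^sub>1\<close>, its mean square
  error under a perturbation \<open>(m + T v, T M T\<^sup>T)\<close> is \<open>\<Sum>\<^sub>i p\<^sub>i (v\<^sub>i\<^sup>2 + M\<^sub>i\<^sub>i)\<close>, and the divergence is \<open>v \<bullet> v / (1 - \<tau>)\<close>
  plus the sum of a convex scalar function over the eigenvalues of \<open>M\<close>. Lagrangian duality
  therefore reduces to a scalar tangent inequality: the worst case has \<open>v = 0\<close> and \<open>M\<close> diagonal, with
  the identity on the \<open>y\<close> block. Under this density the estimator is still optimal, because the density is symmetric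
  under the reflection that changes the sign of \<open>u\<^sub>1\<close>; hence (estimator, density) is a saddle point.
  The divergence of the worst case is strictly decreasing in the multiplier, from infinity to 0.\<close>

subsection \<open>Diagonalisation and matrix functions\<close>

text \<open>Mixtures of Gaussians are not Gaussian, so \<open>ball_tau\<close> is not convex, and
  the competing estimators are arbitrary measurable maps; hence the saddle point is exhibited
  explicitly and its two inequalities are verified separately, without a general minimax theorem.
  Two choices make this possible. Since \<open>T\<close> is block upper triangular, changing
  \<open>X\<close> alone changes only the xx block of the covariance, so the Bayes gain survives the
  perturbation. Since \<open>X\<close> is an orthogonal matrix times a diagonal root, the risk is a
  weighted sum with weights \<open>p\<close> on the x directions and 0 on the y directions. The zero
  weights are why the y block is left alone: there the optimal eigenvalue is
  \<open>tau_inv \<tau> 0 = 1\<close>. The bound (1 - \<tau>) p_i < lam does double duty: it is the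
  domain on which \<open>tau_inv\<close> inverts \<open>tau_fun'\<close>, and for \<tau> < 1 it
  makes a shift of the mean unprofitable, because the gain p_i v_i^2 does not exceed its price lam
  v_i^2 / (1 - \<tau>).\<close>

lemma invertible_inv:
  fixes A :: "real^'n^'n"
  assumes "invertible A"
  shows "A ** matrix_inv A = mat 1" "matrix_inv A ** A = mat 1"
proof -
  have "\<exists>B. A ** B = mat 1 \<and> B ** A = mat 1"
    using assms by (auto simp: invertible_def)
  from someI_ex[OF this]
  show "A ** matrix_inv A = mat 1" "matrix_inv A ** A = mat 1"
    by (auto simp: matrix_inv_def)
qed

lemma matrix_inv_eqI:
  fixes A B :: "real^'n^'n"
  assumes "A ** B = mat 1"
  shows "matrix_inv A = B" "invertible A"
proof -
  show inv: "invertible A" using assms invertible_right_inverse by blast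
  have "matrix_inv A = matrix_inv A ** (A ** B)" by (simp add: assms)
  also have "\<dots> = B" by (simp add: matrix_mul_assoc invertible_inv[OF inv])
  finally show "matrix_inv A = B" .
qed

lemma matrix_inv_mult:
  fixes A B :: "real^'n^'n"
  assumes "invertible A" "invertible B"
  shows "matrix_inv (A ** B) = matrix_inv B ** matrix_inv A"
proof (rule matrix_inv_eqI)
  have "A ** B ** (matrix_inv B ** matrix_inv A) = A ** (B ** matrix_inv B) ** matrix_inv A"
    by (simp add: matrix_mul_assoc)
  then show "A ** B ** (matrix_inv B ** matrix_inv A) = mat 1"
    by (simp add: invertible_inv assms)
qed

lemma invertible_matrix_inv:
  fixes A :: "real^'n^'n"
  shows "invertible A \<Longrightarrow> invertible (matrix_inv A)"
  using invertible_inv invertible_def by blast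

lemma matrix_inv_inv:
  fixes A :: "real^'n^'n"
  assumes "invertible A" shows "matrix_inv (matrix_inv A) = A"
  using matrix_inv_eqI(1) invertible_inv(2)[OF assms] by blast

lemma matrix_inv_transpose:
  fixes A :: "real^'n^'n"
  assumes "invertible A"
  shows "matrix_inv (transpose A) = transpose (matrix_inv A)"
  by (rule matrix_inv_eqI) (simp add: invertible_inv[OF assms] transpose_mat flip: matrix_transpose_mul)

lemma invertible_transpose:
  fixes A :: "real^'n^'n"
  shows "invertible A \<Longrightarrow> invertible (transpose A)"
  by (simp add: invertible_det_nz det_transpose)

lemma matrix_add_rdistrib:
  fixes A B :: "real^'n^'m" and C :: "real^'k^'n"
  shows "(A + B) ** C = A ** C + B ** C"
  by (simp add: matrix_matrix_mult_def vec_eq_iff algebra_simps sum.distrib)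

lemma matrix_mult_scaleR:
  fixes A :: "real^'n^'m" and C :: "real^'k^'n"
  shows "(r *\<^sub>R A) ** C = r *\<^sub>R (A ** C)" "A ** (r *\<^sub>R C) = r *\<^sub>R (A ** C)"
  by (simp_all add: matrix_matrix_mult_def vec_eq_iff sum_distrib_left mult_ac)

lemma matrix_mult_uminus:
  fixes A :: "real^'n^'m" and C :: "real^'k^'n"
  shows "(- A) ** C = - (A ** C)" "A ** (- C) = - (A ** C)"
  by (simp_all add: matrix_matrix_mult_def vec_eq_iff sum_negf)

lemma transpose_0: "transpose (0 :: real^'n^'m) = 0"
  by (simp add: transpose_def vec_eq_iff)

lemma matrix_mult_diag_mat: "(A ** diag_mat d) $ i $ j = A $ i $ j * d $ j"
  by (simp add: matrix_matrix_mult_def diag_mat_def if_distrib [of "\<lambda>x. _ * x"] cong: if_cong)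

lemma diag_mat_mult_matrix: "(diag_mat d ** A) $ i $ j = d $ i * A $ i $ j"
  by (simp add: matrix_matrix_mult_def diag_mat_def if_distrib [of "\<lambda>x. x * _"] cong: if_cong)

lemma diag_mat_mult: "diag_mat d ** diag_mat e = diag_mat (\<chi> i. d $ i * e $ i)"
  by (simp add: vec_eq_iff matrix_mult_diag_mat) (simp add: diag_mat_def)

lemma diag_mat_vec: "(diag_mat d *v v) $ i = d $ i * v $ i"
  by (simp add: matrix_vector_mult_def diag_mat_def if_distrib [of "\<lambda>x. x * _"] cong: if_cong)

lemma transpose_diag_mat: "transpose (diag_mat d) = diag_mat d"
  by (auto simp: vec_eq_iff transpose_def diag_mat_def)

lemma trace_diag_mat: "trace (diag_mat d) = (\<Sum>i\<in>UNIV. d $ i)"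
  by (simp add: trace_def diag_mat_def)

lemma diag_mat_1: "diag_mat (\<chi> i. 1) = mat 1"
  by (auto simp: vec_eq_iff diag_mat_def mat_def)

lemma det_diag_mat: "det (diag_mat d) = (\<Prod>i\<in>UNIV. d $ i)"
  by (subst det_diagonal) (auto simp: diag_mat_def)

lemma trace_conj:
  fixes S A :: "real^'n^'n"
  assumes "invertible S"
  shows "trace (S ** A ** matrix_inv S) = trace A"
  by (subst trace_mul_sym) (simp add: matrix_mul_assoc invertible_inv[OF assms])

text \<open>The intertwining matrix \<open>X = S'\<^sup>-\<^sup>1 S\<close> satisfies \<open>X\<^sub>i\<^sub>j d\<^sub>j = d'\<^sub>i X\<^sub>i\<^sub>j\<close>,
  an identity that survives the application of \<open>f\<close> to both diagonals.\<close>
lemma mat_fun_eq: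
  fixes S :: "real^'n^'n"
  assumes S: "invertible S"
  shows "mat_fun f (S ** diag_mat d ** matrix_inv S) = S ** diag_mat (\<chi> i. f (d $ i)) ** matrix_inv S"
  unfolding mat_fun_def
proof (rule the_equality)
  fix F
  assume "\<exists>(S'::real^'n^'n) d'. invertible S' \<and> S ** diag_mat d ** matrix_inv S = S' ** diag_mat d' ** matrix_inv S'
      \<and> F = S' ** diag_mat (\<chi> i. f (d' $ i)) ** matrix_inv S'"
  then obtain S' :: "real^'n^'n" and d' where S': "invertible S'"
    and eq: "S ** diag_mat d ** matrix_inv S = S' ** diag_mat d' ** matrix_inv S'"
    and F: "F = S' ** diag_mat (\<chi> i. f (d' $ i)) ** matrix_inv S'" by blast
  define X where "X = matrix_inv S' ** S"
  have SX: "S' ** X = S" by (simp add: X_def matrix_mul_assoc invertible_inv[OF S'])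
  have "X ** diag_mat d = matrix_inv S' ** (S ** diag_mat d ** matrix_inv S) ** S"
    by (simp add: X_def invertible_inv[OF S] flip: matrix_mul_assoc)
  also have "\<dots> = (matrix_inv S' ** S') ** diag_mat d' ** X"
    unfolding eq X_def by (simp add: matrix_mul_assoc)
  finally have Xd: "X ** diag_mat d = diag_mat d' ** X"
    by (simp add: invertible_inv[OF S'])
  have "X $ i $ j * d $ j = d' $ i * X $ i $ j" for i j
    using Xd by (metis matrix_mult_diag_mat diag_mat_mult_matrix)
  then have "X $ i $ j * f (d $ j) = f (d' $ i) * X $ i $ j" for i j
    by (cases "X $ i $ j = 0") (auto, metis mult.commute mult_right_cancel)
  then have Xf: "X ** diag_mat (\<chi> i. f (d $ i)) = diag_mat (\<chi> i. f (d' $ i)) ** X"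
    by (simp add: vec_eq_iff matrix_mult_diag_mat diag_mat_mult_matrix)
  have "S ** diag_mat (\<chi> i. f (d $ i)) ** matrix_inv S
      = S' ** (X ** diag_mat (\<chi> i. f (d $ i))) ** matrix_inv S"
    by (simp add: matrix_mul_assoc SX)
  also have "\<dots> = S' ** diag_mat (\<chi> i. f (d' $ i)) ** (matrix_inv S' ** (S ** matrix_inv S))"
    unfolding Xf by (simp add: X_def matrix_mul_assoc)
  also have "\<dots> = F" by (simp add: F invertible_inv[OF S])
  finally show "F = S ** diag_mat (\<chi> i. f (d $ i)) ** matrix_inv S" by simp
qed (use S in blast)

text \<open>A maximiser \<open>v\<close> of the Rayleigh quotient on an invariant subspace is an eigenvector:
  otherwise moving along the component of \<open>A v\<close> orthogonal to \<open>v\<close> would increase the quotient.\<close>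
lemma self_adjoint_eigenvector:
  fixes f :: "'a::euclidean_space \<Rightarrow> 'a"
  assumes lin: "linear f" and sa: "\<And>x y. f x \<bullet> y = x \<bullet> f y"
    and sub: "subspace S" and inv: "\<And>x. x \<in> S \<Longrightarrow> f x \<in> S" and ne: "S \<noteq> {0}"
  obtains v \<mu> where "v \<in> S" "norm v = 1" "f v = \<mu> *\<^sub>R v"
proof -
  let ?C = "S \<inter> sphere 0 1"
  have "compact ?C" by (simp add: closed_Int_compact closed_subspace sub)
  moreover have "?C \<noteq> {}"
  proof -
    obtain x where "x \<in> S" "x \<noteq> 0" using ne sub subspace_0 by blast
    then have "(1 / norm x) *\<^sub>R x \<in> ?C" using sub by (simp add: subspace_scale)
    then show ?thesis by blast
  qed
  moreover have "continuous_on ?C (\<lambda>x. x \<bullet> f x)"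
    by (intro continuous_intros linear_continuous_on) (simp add: lin linear_conv_bounded_linear[symmetric])
  ultimately obtain v where v: "v \<in> ?C" and max: "\<And>x. x \<in> ?C \<Longrightarrow> x \<bullet> f x \<le> v \<bullet> f v"
    using continuous_attains_sup[of ?C "\<lambda>x. x \<bullet> f x"] by blast
  define \<mu> where "\<mu> = v \<bullet> f v"
  have vv: "v \<bullet> v = 1" using v by (simp add: dot_square_norm)
  have le: "x \<bullet> f x \<le> \<mu> * (x \<bullet> x)" if "x \<in> S" for x
  proof (cases "x = 0")
    case False
    then have "(1 / norm x) *\<^sub>R x \<in> ?C" using sub that by (simp add: subspace_scale)
    from max[OF this] have "(1 / norm x)^2 * (x \<bullet> f x) \<le> \<mu>"
      by (simp add: \<mu>_def linear_cmul[OF lin] power2_eq_square)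
    then show ?thesis using False
      by (simp add: power2_norm_eq_inner field_simps power_divide)
  qed simp
  define w where "w = f v - \<mu> *\<^sub>R v"
  have wS: "w \<in> S" using v sub inv by (simp add: w_def subspace_diff subspace_scale)
  have vw: "v \<bullet> w = 0" by (simp add: w_def inner_diff_right vv \<mu>_def)
  have fvw: "f v \<bullet> w = w \<bullet> w" using vw by (simp add: w_def inner_diff_left)
  have "w = 0"
  proof (rule ccontr)
    assume "w \<noteq> 0"
    then have ww: "w \<bullet> w > 0" by simp
    define b where "b = \<mu> * (w \<bullet> w) - w \<bullet> f w"
    have ineq: "2 * t * (w \<bullet> w) \<le> t^2 * b" for t :: real
    proof -
      have "v + t *\<^sub>R w \<in> S" using v wS sub by (simp add: subspace_add subspace_scale)
      from le[OF this] have "\<mu> + 2 * t * (w \<bullet> w) + t^2 * (w \<bullet> f w) \<le> \<mu> * (1 + t^2 * (w \<bullet> w))"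
        using sa[of v w] sa[of w v] fvw vw
        by (simp add: linear_add[OF lin] linear_cmul[OF lin] inner_add_left inner_add_right vv
            inner_commute[of w v] \<mu>_def[symmetric] power2_eq_square algebra_simps inner_commute[of w "f v"])
      then show ?thesis by (simp add: b_def algebra_simps)
    qed
    have b0: "0 \<le> b" using ineq[of 1] ww unfolding power_one mult_1_left mult_1_right by linarith
    \<comment> \<open>A step so small that the second-order term \<open>t * b\<close> cannot
      compensate the first-order gain; \<open>b + 1\<close> instead of \<open>b\<close> keeps the
      denominator positive when \<open>b\<close> is 0.\<close>
    define t where "t = (w \<bullet> w) / (b + 1)"
    have t: "t > 0" using ww b0 by (simp add: t_def)
    have "2 * (w \<bullet> w) \<le> t * b" using ineq[of t] t by (simp add: power2_eq_square)
    also have "\<dots> \<le> w \<bullet> w" using b0 ww by (simp add: t_def field_simps)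
    finally show False using ww by simp
  qed
  then show ?thesis using that[of v \<mu>] v by (simp add: w_def)
qed

text \<open>The claim ranges over all invariant subspaces so that induction on the dimension can
  pass from \<open>S\<close> to the orthogonal complement of an eigenvector in \<open>S\<close>:
  self-adjointness makes this complement invariant again, and its dimension is one less. Taken on
  the whole space it is the spectral theorem.\<close>

lemma self_adjoint_eigenbasis:
  fixes f :: "'a::euclidean_space \<Rightarrow> 'a"
  assumes lin: "linear f" and sa: "\<And>x y. f x \<bullet> y = x \<bullet> f y"
  shows "subspace S \<Longrightarrow> (\<And>x. x \<in> S \<Longrightarrow> f x \<in> S) \<Longrightarrow>
    \<exists>B. B \<subseteq> S \<and> pairwise orthogonal B \<and> (\<forall>v\<in>B. norm v = 1 \<and> (\<exists>\<mu>. f v = \<mu> *\<^sub>R v)) \<and> finite B \<and> card B = dim S"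
proof (induction "dim S" arbitrary: S rule: less_induct)
  case less
  show ?case
  proof (cases "S = {0}")
    case True
    then show ?thesis by (intro exI[of _ "{}"]) auto
  next
    case False
    obtain v \<mu> where v: "v \<in> S" "norm v = 1" "f v = \<mu> *\<^sub>R v"
      by (rule self_adjoint_eigenvector[OF lin sa less.prems False])
    define S' where "S' = S \<inter> {x. orthogonal v x}"
    have sub': "subspace S'" unfolding S'_def
      by (intro subspace_inter less.prems(1) subspace_orthogonal_to_vector)
    have inv': "f x \<in> S'" if "x \<in> S'" for x
    proof -
      have "v \<bullet> f x = f v \<bullet> x" by (simp add: sa)
      then show ?thesis using that less.prems(2) v by (auto simp: S'_def orthogonal_def)
    qed
    have "dim S = dim S' + 1"
    proof -
      have "dim {y \<in> S. \<forall>x \<in> span {v}. orthogonal x y} + dim (span {v}) = dim S"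
        using v less.prems(1)
        by (intro dim_subspace_orthogonal_to_vectors) (auto simp: span_minimal)
      moreover have "{y \<in> S. \<forall>x \<in> span {v}. orthogonal x y} = S'"
      proof -
        have "v \<in> span {v}" by (simp add: span_base)
        then show ?thesis by (auto simp: S'_def span_singleton orthogonal_def)
      qed
      moreover have "dim {v} = 1" using v by (subst dim_eq_card_independent) auto
      ultimately show ?thesis by simp
    qed
    with less.hyps[OF _ sub' inv'] obtain B where
      B: "B \<subseteq> S'" "pairwise orthogonal B" "\<forall>v\<in>B. norm v = 1 \<and> (\<exists>\<mu>. f v = \<mu> *\<^sub>R v)" "finite B" "card B = dim S'"
      by auto
    have "v \<bullet> v \<noteq> 0" using v(2) by auto
    then have "v \<notin> B" using B(1) by (auto simp: S'_def orthogonal_def)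
    with B v \<open>dim S = dim S' + 1\<close> show ?thesis
      by (intro exI[of _ "insert v B"])
        (auto simp: S'_def pairwise_insert orthogonal_commute)
  qed
qed

lemma symmetric_diagonalisation:
  fixes A :: "real^'n^'n"
  assumes "transpose A = A"
  obtains V d where "orthogonal_matrix V" "A = V ** diag_mat d ** transpose V"
proof -
  have sa: "(A *v x) \<bullet> y = x \<bullet> (A *v y)" for x y
    by (metis assms dot_lmul_matrix inner_commute transpose_matrix_vector)
  obtain B where B: "pairwise orthogonal B" "\<And>v. v\<in>B \<Longrightarrow> norm v = 1" "\<And>v. v\<in>B \<Longrightarrow> \<exists>\<mu>. A *v v = \<mu> *\<^sub>R v"
    "finite B" "card B = CARD('n)"
    using self_adjoint_eigenbasis[of "(*v) A" UNIV] sa by auto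
  obtain b :: "'n \<Rightarrow> real^'n" where b: "bij_betw b UNIV B"
    using B(4,5) by (metis finite_class.finite_UNIV finite_same_card_bij)
  have bB: "b i \<in> B" for i using b by (auto simp: bij_betw_def)
  obtain d where d: "\<And>i. A *v b i = d i *\<^sub>R b i" using B(3)[OF bB] by metis
  have bb: "b i \<bullet> b j = (if i = j then 1 else 0)" for i j
  proof (cases "i = j")
    case True
    then show ?thesis using B(2)[OF bB[of j]] by (simp add: norm_eq_1)
  next
    case False
    then have "b i \<noteq> b j" using b by (auto simp: bij_betw_def inj_on_def)
    then show ?thesis using B(1) bB False by (auto simp: pairwise_def orthogonal_def)
  qed
  define V where "V = (\<chi> i j. b j $ i)"
  have VV: "transpose V ** V = mat 1"
    using bb by (simp add: vec_eq_iff matrix_matrix_mult_def transpose_def V_def mat_def inner_vec_def)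
  then have "orthogonal_matrix V" by (simp add: orthogonal_matrix)
  moreover have "A ** V = V ** diag_mat (\<chi> i. d i)"
    using d by (simp add: vec_eq_iff matrix_mult_diag_mat)
      (simp add: matrix_matrix_mult_def matrix_vector_mult_def V_def mult.commute)
  then have "A = V ** diag_mat (\<chi> i. d i) ** transpose V"
    using VV by (metis calculation matrix_mul_assoc matrix_mul_rid orthogonal_matrix_def)
  ultimately show ?thesis using that by blast
qed

lemma pos_def_diagonalisation:
  fixes A :: "real^'n^'n"
  assumes "pos_def A"
  obtains V d where "orthogonal_matrix V" "A = V ** diag_mat d ** transpose V" "\<And>i. d $ i > 0"
proof -
  obtain V d where V: "orthogonal_matrix V" "A = V ** diag_mat d ** transpose V"
    by (rule symmetric_diagonalisation[of A]) (use assms in \<open>auto simp: pos_def_def\<close>)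
  have "d $ i > 0" for i
  proof -
    let ?v = "V *v axis i 1"
    have Vv: "transpose V *v ?v = axis i 1"
      using V(1) by (simp add: matrix_vector_mul_assoc orthogonal_matrix_def)
    then have "?v \<noteq> 0" by (metis axis_eq_0_iff matrix_vector_mult_0_right zero_neq_one)
    then have "0 < ?v \<bullet> (A *v ?v)" using assms by (simp add: pos_def_def)
    also have "\<dots> = (transpose V *v ?v) \<bullet> (diag_mat d *v (transpose V *v ?v))"
      unfolding V(2) by (simp add: dot_lmul_matrix[symmetric] flip: matrix_vector_mul_assoc)
    also have "\<dots> = d $ i" unfolding Vv
      by (simp add: inner_axis' diag_mat_vec)
    finally show ?thesis .
  qed
  with V show ?thesis using that by blast
qed

lemma pos_def_sqrt:
  fixes A :: "real^'n^'n"
  assumes "pos_def A"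
  obtains L :: "real^'n^'n" where "A = L ** transpose L" "invertible L"
proof -
  obtain V d where V: "orthogonal_matrix V" "A = V ** diag_mat d ** transpose V" "\<And>i. d $ i > 0"
    using pos_def_diagonalisation[OF assms] by blast
  define L where "L = V ** diag_mat (\<chi> i. sqrt (d $ i))"
  have "L ** transpose L = V ** (diag_mat (\<chi> i. sqrt (d $ i)) ** diag_mat (\<chi> i. sqrt (d $ i))) ** transpose V"
    by (simp add: L_def matrix_transpose_mul transpose_diag_mat matrix_mul_assoc)
  then have "A = L ** transpose L" using V by (simp add: diag_mat_mult less_imp_le)
  moreover have "invertible L"
  proof -
    have "det V \<noteq> 0" using det_orthogonal_matrix[OF V(1)] by auto
    moreover have "(\<Prod>i\<in>UNIV. sqrt (d $ i)) \<noteq> 0" using V(3) by (simp add: less_imp_neq[symmetric])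
    ultimately show ?thesis by (simp add: L_def invertible_det_nz det_mul det_diag_mat)
  qed
  ultimately show ?thesis using that by blast
qed

text \<open>Two factors come without any regularity: the one picked by \<open>SOME\<close> in
  \<open>tau_div\<close>, and the universally quantified \<open>L\<close> in the final theorem.
  Comparing determinants with an invertible root makes both usable.\<close>

lemma mult_transpose_invertible:
  fixes L :: "real^'n^'n"
  assumes "pos_def (L ** transpose L)" shows "invertible L"
proof -
  obtain L' :: "real^'n^'n" where "L ** transpose L = L' ** transpose L'" "invertible L'" by (rule pos_def_sqrt[OF assms])
  then have "det (L ** transpose L) \<noteq> 0"
    by (metis invertible_det_nz invertible_mult invertible_transpose)
  then have "det L \<noteq> 0" by (simp add: det_mul)
  then show ?thesis by (simp add: invertible_det_nz)
qed

lemma pos_def_mult_transpose: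
  fixes L :: "real^'n^'n"
  assumes "invertible L" shows "pos_def (L ** transpose L)"
  unfolding pos_def_def
proof (intro conjI allI impI)
  fix v :: "real^'n" assume "v \<noteq> 0"
  then have nz: "transpose L *v v \<noteq> 0"
    using invertible_inv(2)[OF invertible_transpose[OF assms]]
    by (metis matrix_vector_mul_assoc matrix_vector_mul_lid matrix_vector_mult_0_right)
  have "v \<bullet> ((L ** transpose L) *v v) = (transpose L *v v) \<bullet> (transpose L *v v)"
    by (simp add: dot_lmul_matrix[symmetric] flip: matrix_vector_mul_assoc)
  then show "0 < v \<bullet> ((L ** transpose L) *v v)" using nz by simp
qed (simp add: matrix_transpose_mul)

subsection \<open>The scalar function behind the divergence\<close>

text \<open>\<open>tau_fun'\<close> is the derivative of \<open>tau_fun\<close>, and \<open>tau_inv\<close> the inverse of \<open>tau_fun'\<close>.\<close>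
definition tau_fun :: "real \<Rightarrow> real \<Rightarrow> real" where
  "tau_fun \<tau> s = (if \<tau> = 0 then s - 1 - ln s
     else if \<tau> < 1 then s powr \<tau> / (\<tau> * (\<tau> - 1)) + s / (1 - \<tau>) + 1 / \<tau>
     else s * ln s - s + 1)"

definition tau_fun' :: "real \<Rightarrow> real \<Rightarrow> real" where
  "tau_fun' \<tau> s = (if \<tau> < 1 then (1 - s powr (\<tau> - 1)) / (1 - \<tau>) else ln s)"

definition tau_inv :: "real \<Rightarrow> real \<Rightarrow> real" where
  "tau_inv \<tau> \<theta> = (if \<tau> < 1 then (1 - (1 - \<tau>) * \<theta>) powr (1 / (\<tau> - 1)) else exp \<theta>)"

lemma tau_fun_deriv:
  assumes "0 \<le> \<tau>" "\<tau> \<le> 1" "s > 0"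
  shows "(tau_fun \<tau> has_real_derivative tau_fun' \<tau> s) (at s)"
proof -
  consider "\<tau> = 0" | "0 < \<tau>" "\<tau> < 1" | "\<tau> = 1" using assms by linarith
  then show ?thesis
  proof cases
    case 1
    then have "tau_fun \<tau> = (\<lambda>s. s - 1 - ln s)" by (simp add: tau_fun_def fun_eq_iff)
    then show ?thesis using 1 assms(3)
      by (auto intro!: derivative_eq_intros simp: tau_fun'_def powr_minus powr_one inverse_eq_divide)
  next
    case 2
    then have "tau_fun \<tau> = (\<lambda>s. s powr \<tau> / (\<tau> * (\<tau> - 1)) + s / (1 - \<tau>) + 1 / \<tau>)"
      by (simp add: tau_fun_def fun_eq_iff)
    moreover have "((\<lambda>s. s powr \<tau> / (\<tau> * (\<tau> - 1)) + s / (1 - \<tau>) + 1 / \<tau>) has_real_derivative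
        \<tau> * s powr (\<tau> - 1) / (\<tau> * (\<tau> - 1)) + 1 / (1 - \<tau>) + 0) (at s)"
      by (intro derivative_intros DERIV_cdivide has_real_derivative_powr assms)
    moreover have "\<tau> * s powr (\<tau> - 1) / (\<tau> * (\<tau> - 1)) + 1 / (1 - \<tau>) + 0 = tau_fun' \<tau> s"
      using 2 by (simp add: tau_fun'_def divide_simps) (simp add: algebra_simps)
    ultimately show ?thesis by metis
  next
    case 3
    then have "tau_fun \<tau> = (\<lambda>s. s * ln s - s + 1)" by (simp add: tau_fun_def fun_eq_iff)
    then show ?thesis using 3 assms(3)
      by (auto intro!: derivative_eq_intros simp: tau_fun'_def)
  qed
qed

lemma tau_fun'_mono:
  assumes "0 < s" "s \<le> t"
  shows "tau_fun' \<tau> s \<le> tau_fun' \<tau> t"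
proof -
  have "t powr (\<tau> - 1) \<le> s powr (\<tau> - 1)" if "\<tau> < 1"
    using assms that by (intro powr_mono2') auto
  then show ?thesis using assms by (auto simp: tau_fun'_def intro!: divide_right_mono)
qed

text \<open>Convexity in the form that the duality argument uses. The mean value point lies between
  \<open>s\<close> and \<open>t\<close>, and monotonicity of \<open>tau_fun'\<close> compares the
  slope there with the slope at \<open>s\<close>.\<close>

lemma tau_fun_tangent:
  assumes "0 \<le> \<tau>" "\<tau> \<le> 1" "s > 0" "t > 0"
  shows "tau_fun \<tau> s + tau_fun' \<tau> s * (t - s) \<le> tau_fun \<tau> t"
proof -
  consider "s = t" | "s < t" | "t < s" by linarith
  then show ?thesis
  proof cases
    case 2
    with MVT2[OF 2, of "tau_fun \<tau>" "tau_fun' \<tau>"] tau_fun_deriv[OF assms(1,2)] assms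
    obtain z where z: "s < z" "tau_fun \<tau> t - tau_fun \<tau> s = (t - s) * tau_fun' \<tau> z" by force
    have "tau_fun' \<tau> s * (t - s) \<le> tau_fun' \<tau> z * (t - s)"
      using z 2 assms by (intro mult_right_mono tau_fun'_mono) auto
    then show ?thesis using z by (simp add: algebra_simps)
  next
    case 3
    with MVT2[OF 3, of "tau_fun \<tau>" "tau_fun' \<tau>"] tau_fun_deriv[OF assms(1,2)] assms
    obtain z where z: "t < z" "z < s" "tau_fun \<tau> s - tau_fun \<tau> t = (s - t) * tau_fun' \<tau> z" by force
    have "tau_fun' \<tau> z * (s - t) \<le> tau_fun' \<tau> s * (s - t)"
      using z 3 assms by (intro mult_right_mono tau_fun'_mono) auto
    then show ?thesis using z by (simp add: algebra_simps)
  qed simp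
qed

lemma tau_fun_1 [simp]: "0 \<le> \<tau> \<Longrightarrow> \<tau> \<le> 1 \<Longrightarrow> tau_fun \<tau> 1 = 0"
  by (auto simp: tau_fun_def divide_simps) (simp add: algebra_simps)

lemma tau_fun_nonneg:
  assumes "0 \<le> \<tau>" "\<tau> \<le> 1" "s > 0"
  shows "0 \<le> tau_fun \<tau> s"
  using tau_fun_tangent[of \<tau> 1 s] assms by (simp add: tau_fun'_def split: if_splits)

lemma tau_inv_0 [simp]: "tau_inv \<tau> 0 = 1"
  by (simp add: tau_inv_def)

lemma tau_inv_pos: "(1 - \<tau>) * \<theta> < 1 \<Longrightarrow> 0 < tau_inv \<tau> \<theta>"
  by (simp add: tau_inv_def)

lemma tau_fun'_tau_inv:
  assumes "\<tau> \<le> 1" "(1 - \<tau>) * \<theta> < 1"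
  shows "tau_fun' \<tau> (tau_inv \<tau> \<theta>) = \<theta>"
  using assms by (auto simp: tau_fun'_def tau_inv_def powr_powr)

lemma tau_inv_tau_fun':
  assumes "\<tau> \<le> 1" "s > 0"
  shows "tau_inv \<tau> (tau_fun' \<tau> s) = s" "(1 - \<tau>) * tau_fun' \<tau> s < 1"
  using assms by (auto simp: tau_fun'_def tau_inv_def powr_powr)

lemma tau_inv_strict_mono:
  assumes "\<tau> \<le> 1" "\<theta> < \<theta>'" "(1 - \<tau>) * \<theta>' < 1"
  shows "tau_inv \<tau> \<theta> < tau_inv \<tau> \<theta>'"
proof (rule ccontr)
  have "(1 - \<tau>) * \<theta> \<le> (1 - \<tau>) * \<theta>'" using assms by (intro mult_left_mono) auto
  then have 1: "(1 - \<tau>) * \<theta> < 1" using assms by linarith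
  assume "\<not> tau_inv \<tau> \<theta> < tau_inv \<tau> \<theta>'"
  then have "tau_fun' \<tau> (tau_inv \<tau> \<theta>') \<le> tau_fun' \<tau> (tau_inv \<tau> \<theta>)"
    using assms by (intro tau_fun'_mono tau_inv_pos) auto
  then show False using assms 1 by (simp add: tau_fun'_tau_inv)
qed

lemma tau_fun_tau_inv_strict_mono:
  assumes "0 \<le> \<tau>" "\<tau> \<le> 1" "0 \<le> \<theta>" "\<theta> < \<theta>'" "(1 - \<tau>) * \<theta>' < 1"
  shows "tau_fun \<tau> (tau_inv \<tau> \<theta>) < tau_fun \<tau> (tau_inv \<tau> \<theta>')"
proof -
  \<comment> \<open>For \<open>\<theta> = 0\<close> the tangent has slope 0 and yields only a weak
    inequality. At the midpoint the slope is positive, so the second half of the interval supplies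
    the strictness.\<close>
  let ?\<eta> = "(\<theta> + \<theta>') / 2"
  have le: "(1 - \<tau>) * x < 1" if "x \<le> \<theta>'" for x
    using assms mult_left_mono[OF that, of "1 - \<tau>"] by simp
  have "tau_fun \<tau> (tau_inv \<tau> \<theta>) \<le> tau_fun \<tau> (tau_inv \<tau> \<theta>) + tau_fun' \<tau> (tau_inv \<tau> \<theta>) * (tau_inv \<tau> ?\<eta> - tau_inv \<tau> \<theta>)"
    using assms le[of \<theta>] le[of ?\<eta>] tau_inv_strict_mono[of \<tau> \<theta> ?\<eta>] by (simp add: tau_fun'_tau_inv)
  also have "\<dots> \<le> tau_fun \<tau> (tau_inv \<tau> ?\<eta>)"
    using assms le[of \<theta>] le[of ?\<eta>] le[of \<theta>'] tau_inv_pos by (intro tau_fun_tangent) auto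
  also have "\<dots> < tau_fun \<tau> (tau_inv \<tau> ?\<eta>) + tau_fun' \<tau> (tau_inv \<tau> ?\<eta>) * (tau_inv \<tau> \<theta>' - tau_inv \<tau> ?\<eta>)"
    using assms le[of ?\<eta>] tau_inv_strict_mono[of \<tau> ?\<eta> \<theta>'] by (simp add: tau_fun'_tau_inv)
  also have "\<dots> \<le> tau_fun \<tau> (tau_inv \<tau> \<theta>')"
    using assms le[of \<theta>] le[of ?\<eta>] le[of \<theta>'] tau_inv_pos by (intro tau_fun_tangent) auto
  finally show ?thesis .
qed

lemma tau_fun_tau_inv_continuous:
  assumes "0 \<le> \<tau>" "\<tau> \<le> 1" "(1 - \<tau>) * \<theta> < 1"
  shows "isCont (\<lambda>\<theta>. tau_fun \<tau> (tau_inv \<tau> \<theta>)) \<theta>"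
proof (rule isCont_o2[where f = "tau_inv \<tau>"])
  show "isCont (tau_fun \<tau>) (tau_inv \<tau> \<theta>)"
    using tau_fun_deriv[OF assms(1,2) tau_inv_pos[OF assms(3)]] by (rule DERIV_isCont)
  show "isCont (tau_inv \<tau>) \<theta>"
    unfolding tau_inv_def[abs_def] using assms by (cases "\<tau> < 1") (auto intro!: continuous_intros)
qed

text \<open>A convex function dominates its tangent at 2, whose slope is positive because 2 lies to
  the right of the minimum at 1. The witness \<open>s\<close> is where this line has risen by |c|
  above a nonnegative value.\<close>

lemma tau_fun_unbounded:
  assumes "0 \<le> \<tau>" "\<tau> \<le> 1"
  obtains s where "s > 1" "c \<le> tau_fun \<tau> s" "tau_fun' \<tau> s > 0"
proof -
  have pos: "tau_fun' \<tau> s > 0" if "s > 1" for s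
  proof -
    have "s powr (\<tau> - 1) < 1" if "\<tau> < 1"
      using that \<open>s > 1\<close> powr_less_mono[of "\<tau> - 1" 0 s] by simp
    then show ?thesis using that by (auto simp: tau_fun'_def)
  qed
  define s where "s = 2 + \<bar>c\<bar> / tau_fun' \<tau> 2"
  have s: "s \<ge> 2" using pos[of 2] by (simp add: s_def)
  have "c \<le> tau_fun \<tau> 2 + tau_fun' \<tau> 2 * (s - 2)"
    using pos[of 2] tau_fun_nonneg[OF assms, of 2] by (simp add: s_def)
  also have "\<dots> \<le> tau_fun \<tau> s"
    using s by (intro tau_fun_tangent assms) auto
  finally show ?thesis using that[of s] s pos[of s] by simp
qed

section \<open>Existence and uniqueness of the Lagrange multiplier\<close>

lemma tau_multiplier_exists:
  fixes p :: "real^'n"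
  assumes \<tau>: "0 \<le> \<tau>" "\<tau> \<le> 1" and p: "\<And>i. p $ i > 0" and c: "c > 0"
  obtains lam where "lam > 0" "\<And>i. (1 - \<tau>) * p $ i < lam"
    "(\<Sum>i\<in>UNIV. tau_fun \<tau> (tau_inv \<tau> (p $ i / lam))) = c"
proof -
  define pm where "pm = Max (range (\<lambda>i. p $ i))"
  have pm: "p $ i \<le> pm" for i by (simp add: pm_def)
  have "pm \<in> range (\<lambda>i. p $ i)" unfolding pm_def by (intro Max_in) auto
  then obtain k where k: "p $ k = pm" by auto
  have pm0: "pm > 0" using p[of k] k by simp
  obtain s where s: "s > 1" "c \<le> tau_fun \<tau> s" "tau_fun' \<tau> s > 0"
    using tau_fun_unbounded[OF \<tau>] .
  \<comment> \<open>The right end of the search interval for t = 1 / lam: here the largest weight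
    \<open>pm\<close> is sent exactly to \<open>s\<close>, whose single term already reaches
    \<open>c\<close>, while all smaller weights stay in the domain of
    \<open>tau_inv\<close>.\<close>
  define t1 where "t1 = tau_fun' \<tau> s / pm"
  have t1: "t1 > 0" using s pm0 by (simp add: t1_def)
  have dom: "(1 - \<tau>) * (t * p $ i) < 1" if "0 \<le> t" "t \<le> t1" for t i
  proof -
    have "t * p $ i \<le> t1 * pm" using that p[of i] pm[of i] by (intro mult_mono) auto
    then have "(1 - \<tau>) * (t * p $ i) \<le> (1 - \<tau>) * (t1 * pm)" using \<tau> by (intro mult_left_mono) auto
    also have "\<dots> < 1" using tau_inv_tau_fun'(2)[OF \<tau>(2), of s] s pm0 by (simp add: t1_def)
    finally show ?thesis .
  qed
  \<comment> \<open>Written in t = 1 / lam, the divergence extends continuously to t = 0, that is to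
    an infinite multiplier, where every eigenvalue is 1 and the sum vanishes; so the intermediate
    value theorem applies on a compact interval.\<close>
  define H where "H = (\<lambda>t. \<Sum>i\<in>UNIV. tau_fun \<tau> (tau_inv \<tau> (t * p $ i)))"
  have "\<exists>t. 0 \<le> t \<and> t \<le> t1 \<and> H t = c"
  proof (rule IVT)
    show "H 0 \<le> c" using \<tau> c by (simp add: H_def)
    have "c \<le> tau_fun \<tau> (tau_inv \<tau> (t1 * p $ k))"
      using s pm0 \<tau> by (simp add: t1_def k tau_inv_tau_fun')
    also have "\<dots> \<le> H t1" unfolding H_def
      using dom[of t1] t1 \<tau> by (intro member_le_sum tau_fun_nonneg tau_inv_pos) auto
    finally show "c \<le> H t1" .
    show "\<forall>t. 0 \<le> t \<and> t \<le> t1 \<longrightarrow> isCont H t"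
    proof (intro allI impI)
      fix t assume "0 \<le> t \<and> t \<le> t1"
      then show "isCont H t" unfolding H_def
        using dom \<tau> by (intro continuous_sum isCont_o2[OF _ tau_fun_tau_inv_continuous]) auto
    qed
  qed (use t1 in auto)
  then obtain t where t: "0 \<le> t" "t \<le> t1" "H t = c" by blast
  have "t \<noteq> 0" using t(3) c \<tau> by (auto simp: H_def)
  then have t0: "t > 0" using t by simp
  show ?thesis
  proof (rule that[of "1 / t"])
    show "(1 - \<tau>) * p $ i < 1 / t" for i
      using dom[OF t(1,2), of i] t0 by (simp add: field_simps)
    show "(\<Sum>i\<in>UNIV. tau_fun \<tau> (tau_inv \<tau> (p $ i / (1 / t)))) = c"
      using t(3) by (simp add: H_def mult.commute)
  qed (use t0 in simp)
qed

lemma tau_multiplier_unique: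
  fixes p :: "real^'n"
  assumes \<tau>: "0 \<le> \<tau>" "\<tau> \<le> 1" and p: "\<And>i. p $ i > 0"
    and lam: "lam > 0" "\<And>i. (1 - \<tau>) * p $ i < lam"
    and lam': "lam' > 0" "\<And>i. (1 - \<tau>) * p $ i < lam'"
    and eq: "(\<Sum>i\<in>UNIV. tau_fun \<tau> (tau_inv \<tau> (p $ i / lam))) = (\<Sum>i\<in>UNIV. tau_fun \<tau> (tau_inv \<tau> (p $ i / lam')))"
  shows "lam' = lam"
proof -
  have less: "(\<Sum>i\<in>UNIV. tau_fun \<tau> (tau_inv \<tau> (p $ i / b))) < (\<Sum>i\<in>UNIV. tau_fun \<tau> (tau_inv \<tau> (p $ i / a)))"
    if "0 < a" "a < b" "\<And>i. (1 - \<tau>) * p $ i < a" for a b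
    using that p \<tau> by (intro sum_strict_mono tau_fun_tau_inv_strict_mono) (auto simp: field_simps less_imp_le)
  show ?thesis
    using less[of lam lam'] less[of lam' lam] lam lam' eq
    by (cases lam lam' rule: linorder_cases) auto
qed

subsection \<open>Linear change of variables\<close>

lemma nn_integral_lborel_split:
  fixes f :: "'a::euclidean_space \<Rightarrow> ennreal"
  assumes [measurable]: "f \<in> borel_measurable borel" and i: "i \<in> Basis"
  shows "(\<integral>\<^sup>+ x. f x \<partial>lborel)
    = (\<integral>\<^sup>+ x. (\<integral>\<^sup>+ y. f ((\<Sum>b\<in>Basis - {i}. x b *\<^sub>R b) + y *\<^sub>R i) \<partial>lborel) \<partial>(\<Pi>\<^sub>M b\<in>Basis - {i}. lborel))"
proof -
  interpret product_sigma_finite "\<lambda>_::'a. lborel :: real measure" by standard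
  have ins: "insert i (Basis - {i}) = Basis" using i by auto
  have "(\<integral>\<^sup>+ x. f x \<partial>lborel) = (\<integral>\<^sup>+ x. f (\<Sum>b\<in>Basis. x b *\<^sub>R b) \<partial>(\<Pi>\<^sub>M b\<in>Basis. lborel))"
    by (subst lborel_eq) (simp add: nn_integral_distr)
  also have "\<dots> = (\<integral>\<^sup>+ x. (\<integral>\<^sup>+ y. f (\<Sum>b\<in>Basis. (x(i := y)) b *\<^sub>R b) \<partial>lborel) \<partial>(\<Pi>\<^sub>M b\<in>Basis - {i}. lborel))"
    using product_nn_integral_insert[of "Basis - {i}" i "\<lambda>x. f (\<Sum>b\<in>Basis. x b *\<^sub>R b)"]
    unfolding ins by simp
  also have "(\<lambda>x y. f (\<Sum>b\<in>Basis. (x(i := y)) b *\<^sub>R b)) = (\<lambda>x y. f ((\<Sum>b\<in>Basis - {i}. x b *\<^sub>R b) + y *\<^sub>R i))"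
    using i by (intro ext, subst sum.remove[of _ i]) (auto simp: add.commute)
  finally show ?thesis .
qed

text \<open>With all coordinates except \<open>i\<close> held fixed, \<open>x \<bullet> j\<close> is
  constant because \<open>j\<close> differs from \<open>i\<close>, so the shear is a translation of
  the coordinate \<open>i\<close> alone.\<close>

lemma nn_integral_lborel_shear:
  fixes f :: "'a::euclidean_space \<Rightarrow> ennreal"
  assumes [measurable]: "f \<in> borel_measurable borel" and ij: "i \<in> Basis" "j \<in> Basis" "i \<noteq> j"
  shows "(\<integral>\<^sup>+ x. f (x + (x \<bullet> j) *\<^sub>R i) \<partial>lborel) = (\<integral>\<^sup>+ x. f x \<partial>lborel)"
proof -
  have shift: "(\<integral>\<^sup>+ y. g (y + t) \<partial>lborel) = (\<integral>\<^sup>+ y. g y \<partial>lborel)"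
    if [measurable]: "g \<in> borel_measurable borel" for g :: "real \<Rightarrow> ennreal" and t
    using nn_integral_real_affine[of g 1 t] by (simp add: add.commute)
  have *: "((\<Sum>b\<in>Basis - {i}. x b *\<^sub>R b) + y *\<^sub>R i) \<bullet> j = x j" for x y
  proof -
    have "(\<Sum>b\<in>Basis - {i}. x b * (b \<bullet> j)) = (\<Sum>b\<in>Basis - {i}. if b = j then x b else 0)"
      using ij by (intro sum.cong) (auto simp: inner_Basis)
    then show ?thesis using ij by (simp add: inner_add_left inner_sum_left inner_Basis)
  qed
  have "(\<integral>\<^sup>+ x. f (x + (x \<bullet> j) *\<^sub>R i) \<partial>lborel)
    = (\<integral>\<^sup>+ x. (\<integral>\<^sup>+ y. f ((\<Sum>b\<in>Basis - {i}. x b *\<^sub>R b) + (y + x j) *\<^sub>R i) \<partial>lborel) \<partial>(\<Pi>\<^sub>M b\<in>Basis - {i}. lborel))"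
    by (subst nn_integral_lborel_split[OF _ ij(1)]) (simp_all only: *, simp_all add: scaleR_add_left add_ac)
  also have "\<dots> = (\<integral>\<^sup>+ x. (\<integral>\<^sup>+ y. f ((\<Sum>b\<in>Basis - {i}. x b *\<^sub>R b) + y *\<^sub>R i) \<partial>lborel) \<partial>(\<Pi>\<^sub>M b\<in>Basis - {i}. lborel))"
    by (intro nn_integral_cong shift) measurable
  also have "\<dots> = (\<integral>\<^sup>+ x. f x \<partial>lborel)"
    by (rule nn_integral_lborel_split[symmetric, OF _ ij(1)]) simp
  finally show ?thesis .
qed

lemma Basis_vec_real: "(Basis :: (real^'n) set) = range (\<lambda>i. axis i 1)"
  by (auto simp: Basis_vec_def)

lemma prod_Basis_vec: "(\<Prod>b\<in>(Basis :: (real^'n) set). g b) = (\<Prod>i\<in>UNIV. g (axis i 1))"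
  unfolding Basis_vec_real by (subst prod.reindex) (auto simp: inj_on_def axis_eq_axis)

lemma sum_Basis_vec: "(\<Sum>b\<in>(Basis :: (real^'n) set). g b) = (\<Sum>i\<in>UNIV. g (axis i 1))"
  unfolding Basis_vec_real by (subst sum.reindex) (auto simp: inj_on_def axis_eq_axis)

lemma lborel_permute:
  fixes p :: "'n::finite \<Rightarrow> 'n"
  assumes p: "bij p"
  shows "distr lborel borel (\<lambda>x::real^'n. \<chi> i. x $ p i) = lborel"
proof (rule lborel_eqI[symmetric])
  fix l u :: "real^'n"
  assume "\<And>b. b \<in> Basis \<Longrightarrow> l \<bullet> b \<le> u \<bullet> b"
  from this[of "axis i 1" for i] have le: "l $ i \<le> u $ i" for i
    by (simp add: Basis_vec_real inner_axis)
  let ?q = "inv p"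
  have pq: "p (?q i) = i" "?q (p i) = i" for i
    using p by (auto simp: bij_def surj_f_inv_f inv_f_f)
  have [measurable]: "(\<lambda>x::real^'n. \<chi> i. x $ p i) \<in> borel_measurable borel"
    by (intro borel_measurable_continuous_onI continuous_intros)
  have "(\<lambda>x::real^'n. \<chi> i. x $ p i) -` box l u = box (\<chi> i. l $ ?q i) (\<chi> i. u $ ?q i)"
    using pq by (auto simp: mem_box_cart) metis+
  then have "emeasure (distr lborel borel (\<lambda>x::real^'n. \<chi> i. x $ p i)) (box l u)
    = emeasure lborel (box (\<chi> i. l $ ?q i) (\<chi> i. u $ ?q i))"
    by (simp add: emeasure_distr)
  also have "\<dots> = (\<Prod>i\<in>UNIV. u $ ?q i - l $ ?q i)"
  proof (subst emeasure_lborel_box)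
    show "(\<chi> i. l $ ?q i) \<bullet> b \<le> (\<chi> i. u $ ?q i) \<bullet> b" if "b \<in> Basis" for b
      using that le by (auto simp: Basis_vec_real inner_axis)
  qed (simp add: prod_Basis_vec inner_axis)
  also have "(\<Prod>i\<in>UNIV. u $ ?q i - l $ ?q i) = (\<Prod>i\<in>UNIV. u $ i - l $ i)"
    using bij_imp_bij_inv[OF p] by (intro prod.reindex_bij_betw[where g = "\<lambda>i. u $ i - l $ i"])
  finally show "emeasure (distr lborel borel (\<lambda>x::real^'n. \<chi> i. x $ p i)) (box l u) = ennreal (\<Prod>b\<in>Basis. (u - l) \<bullet> b)"
    by (simp add: prod_Basis_vec inner_axis)
qed simp

lemma borel_measurable_matrix_vector_mult [measurable]:
  "(*v) (A :: real^'n^'m) \<in> borel_measurable borel"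
  by (intro borel_measurable_continuous_onI linear_continuous_on matrix_vector_mul_bounded_linear)

text \<open>The claim is multiplicative in \<open>A\<close>, so it suffices to check the generators
  of the elementary matrix induction: zero row, diagonal, transposition of two coordinates, and
  shear.\<close>

lemma nn_integral_lborel_linear:
  fixes A :: "real^'n^'n"
  assumes "det A \<noteq> 0" "f \<in> borel_measurable borel"
  shows "ennreal \<bar>det A\<bar> * (\<integral>\<^sup>+ x. f (A *v x) \<partial>lborel) = (\<integral>\<^sup>+ x. f x \<partial>lborel)"
proof -
  \<comment> \<open>The condition on the determinant is a premise inside \<open>Q\<close>, so that
    matrices with a zero row, which occur in the induction, satisfy it vacuously.\<close>
  define Q where "Q = (\<lambda>A::real^'n^'n. det A \<noteq> 0 \<longrightarrow> (\<forall>f\<in>borel_measurable borel.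
    ennreal \<bar>det A\<bar> * (\<integral>\<^sup>+ x. f (A *v x) \<partial>lborel) = (\<integral>\<^sup>+ x. f x \<partial>lborel)))"
  have "Q A"
  proof (rule induct_matrix_elementary_alt)
    fix A B :: "real^'n^'n"
    assume A: "Q A" and B: "Q B"
    show "Q (A ** B)" unfolding Q_def
    proof (intro impI ballI)
      fix f :: "real^'n \<Rightarrow> ennreal" assume nz: "det (A ** B) \<noteq> 0" and [measurable]: "f \<in> borel_measurable borel"
      then have nz: "det A \<noteq> 0" "det B \<noteq> 0" by (auto simp: det_mul)
      have "ennreal \<bar>det A\<bar> * (ennreal \<bar>det B\<bar> * (\<integral>\<^sup>+ x. f (A *v (B *v x)) \<partial>lborel)) = (\<integral>\<^sup>+ x. f x \<partial>lborel)"
        using A[unfolded Q_def, rule_format, OF nz(1), of f]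
          B[unfolded Q_def, rule_format, OF nz(2), of "\<lambda>x. f (A *v x)"] by simp
      then show "ennreal \<bar>det (A ** B)\<bar> * (\<integral>\<^sup>+ x. f ((A ** B) *v x) \<partial>lborel) = (\<integral>\<^sup>+ x. f x \<partial>lborel)"
        by (simp add: det_mul abs_mult ennreal_mult matrix_vector_mul_assoc mult.assoc)
    qed
  next
    fix A :: "real^'n^'n" and i assume "row i A = 0"
    then show "Q A" by (simp add: Q_def det_zero_row)
  next
    fix A :: "real^'n^'n" assume diag: "\<And>i j. i \<noteq> j \<Longrightarrow> A $ i $ j = 0"
    have det: "det A = (\<Prod>i\<in>UNIV. A $ i $ i)" using diag by (rule det_diagonal)
    show "Q A" unfolding Q_def
    proof (intro impI ballI)
      fix f :: "real^'n \<Rightarrow> ennreal" assume nz: "det A \<noteq> 0" and [measurable]: "f \<in> borel_measurable borel"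
      define c where "c b = (A *v b) \<bullet> b" for b
      have c: "c (axis i 1) = A $ i $ i" for i
        by (simp add: c_def inner_axis matrix_vector_mult_basis column_def)
      have nzc: "c b \<noteq> 0" if "b \<in> Basis" for b
        using nz that c by (auto simp: det Basis_vec_real)
      have T: "(\<Sum>j\<in>Basis. (c j * (x \<bullet> j)) *\<^sub>R j) = A *v x" for x
      proof -
        have "(\<Sum>j\<in>UNIV. A $ i $ j * x $ j) = A $ i $ i * x $ i" for i
          using diag by (subst sum.remove[of _ i]) auto
        then show ?thesis
          by (simp add: sum_Basis_vec c inner_axis vec_eq_iff matrix_vector_mult_def)
            (simp add: axis_def if_distrib cong: if_cong)
      qed
      have "(\<integral>\<^sup>+ x. f x \<partial>lborel) = (\<integral>\<^sup>+ x. f x \<partial>(density (distr lborel borel (\<lambda>x. 0 + (\<Sum>j\<in>Basis. (c j * (x \<bullet> j)) *\<^sub>R j))) (\<lambda>_. \<Prod>j\<in>Basis. \<bar>c j\<bar>)))"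
        using lborel_affine_euclidean[of c 0] nzc by simp
      also have "\<dots> = ennreal \<bar>det A\<bar> * (\<integral>\<^sup>+ x. f (A *v x) \<partial>lborel)"
        by (simp add: T nn_integral_density nn_integral_distr nn_integral_cmult prod_Basis_vec c det abs_prod)
      finally show "ennreal \<bar>det A\<bar> * (\<integral>\<^sup>+ x. f (A *v x) \<partial>lborel) = (\<integral>\<^sup>+ x. f x \<partial>lborel)" by simp
    qed
  next
    fix m n :: 'n assume "m \<noteq> n"
    let ?p = "Transposition.transpose m n"
    let ?A = "(\<chi> i j. mat 1 $ i $ ?p j) :: real^'n^'n"
    have p: "?p permutes UNIV" by (rule permutes_swap_id) auto
    have det: "\<bar>det ?A\<bar> = 1"
      using det_permute_columns[OF p, of "mat 1 :: real^'n^'n"] by (simp add: sign_def)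
    have A: "?A *v x = (\<chi> i. x $ ?p i)" for x :: "real^'n"
    proof -
      have "(mat 1 :: real^'n^'n) $ i $ ?p j * x $ j = (if j = ?p i then x $ j else 0)" for i j
        by (auto simp: mat_def)
      then show ?thesis by (simp add: vec_eq_iff matrix_vector_mult_def)
    qed
    show "Q ?A" unfolding Q_def
    proof (intro impI ballI)
      fix f :: "real^'n \<Rightarrow> ennreal" assume [measurable]: "f \<in> borel_measurable borel"
      have [measurable]: "(\<lambda>x::real^'n. \<chi> i. x $ ?p i) \<in> borel_measurable borel"
        by (intro borel_measurable_continuous_onI continuous_intros)
      have "(\<integral>\<^sup>+ x. f x \<partial>lborel) = (\<integral>\<^sup>+ x. f x \<partial>(distr lborel borel (\<lambda>x::real^'n. \<chi> i. x $ ?p i)))"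
        using p by (simp add: lborel_permute permutes_bij)
      also have "\<dots> = (\<integral>\<^sup>+ x. f (\<chi> i. x $ ?p i) \<partial>lborel)" by (simp add: nn_integral_distr)
      finally show "ennreal \<bar>det ?A\<bar> * (\<integral>\<^sup>+ x. f (?A *v x) \<partial>lborel) = (\<integral>\<^sup>+ x. f x \<partial>lborel)"
        unfolding det A by simp
    qed
  next
    fix m n :: 'n assume mn: "m \<noteq> n"
    let ?A = "(\<chi> i j. of_bool (i = m \<and> j = n \<or> i = j)) :: real^'n^'n"
    have det: "det ?A = 1"
    proof -
      have "?A = (\<chi> i. if i = m then row m (mat 1) + 1 *s row n (mat 1) else row i (mat 1))"
        using mn by (auto simp: vec_eq_iff row_def mat_def)
      then show ?thesis by (simp add: det_row_operation[OF mn])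
    qed
    have A: "?A *v x = x + (x \<bullet> axis n 1) *\<^sub>R axis m 1" for x :: "real^'n"
    proof -
      have "of_bool (i = m \<and> j = n \<or> i = j) * x $ j
          = (if j = i then x $ j else 0) + (if j = n then of_bool (i = m) * x $ j else 0)" for i j
        using mn by auto
      then show ?thesis
        by (simp add: vec_eq_iff matrix_vector_mult_def sum.distrib inner_axis) (simp add: axis_def)
    qed
    show "Q ?A" unfolding Q_def det A
      using mn nn_integral_lborel_shear[of _ "axis m (1::real)" "axis n 1"]
      by (auto simp: Basis_vec_real axis_eq_axis)
  qed
  then show ?thesis using assms by (simp add: Q_def)
qed

subsection \<open>Gaussian moments\<close>

lemma linear_axis: "linear (axis i :: 'b::real_vector \<Rightarrow> 'b^'n)"
  by (rule linearI) (auto simp: axis_def vec_eq_iff)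

lemma has_bochner_integral_vec:
  fixes f :: "'a \<Rightarrow> 'b::euclidean_space^'n"
  assumes "\<And>i. has_bochner_integral M (\<lambda>x. f x $ i) (v $ i)"
  shows "has_bochner_integral M f v"
proof -
  have *: "w = (\<Sum>i\<in>UNIV. axis i (w $ i))" for w :: "'b^'n"
    by (simp add: vec_eq_iff axis_def)
  have "has_bochner_integral M (\<lambda>x. \<Sum>i\<in>UNIV. axis i (f x $ i)) (\<Sum>i\<in>UNIV. axis i (v $ i))"
    by (intro has_bochner_integral_sum has_bochner_integral_bounded_linear[OF _ assms])
      (simp add: linear_axis flip: linear_conv_bounded_linear)
  then show ?thesis by (simp flip: *)
qed

lemma gauss_pdf_nonneg: "0 \<le> gauss_pdf m K z"
  by (simp add: gauss_pdf_def)

lemma borel_measurable_gauss_pdf [measurable]: "gauss_pdf m K \<in> borel_measurable borel"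
  unfolding gauss_pdf_def[abs_def]
  by (intro borel_measurable_continuous_onI continuous_intros
      linear_continuous_on_compose[OF _ matrix_vector_mul_linear]) auto

lemma gauss_pdf_affine:
  fixes T :: "real^'q^'q"
  assumes T: "invertible T"
  shows "\<bar>det T\<bar> * gauss_pdf m (T ** transpose T) (m + T *v u) = gauss_pdf 0 (mat 1) u"
proof -
  have "matrix_inv (T ** transpose T) = transpose (matrix_inv T) ** matrix_inv T"
    by (simp add: matrix_inv_mult T invertible_transpose matrix_inv_transpose)
  then have "(T *v u) \<bullet> (matrix_inv (T ** transpose T) *v (T *v u))
    = (T *v u) \<bullet> (transpose (matrix_inv T) *v ((matrix_inv T ** T) *v u))"
    by (simp add: matrix_vector_mul_assoc matrix_mul_assoc)
  also have "\<dots> = (u v* matrix_inv T) \<bullet> (T *v u)"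
    by (simp add: invertible_inv[OF T] inner_commute)
  also have "\<dots> = u \<bullet> u"
    by (simp add: dot_lmul_matrix matrix_vector_mul_assoc invertible_inv[OF T])
  finally have quad: "(T *v u) \<bullet> (matrix_inv (T ** transpose T) *v (T *v u)) = u \<bullet> u" .
  have "det T \<noteq> 0" using T by (simp add: invertible_det_nz)
  then have "\<bar>det T\<bar> * det (T ** transpose T) powr (-1/2) = 1"
    by (simp add: det_mul powr_minus powr_half_sqrt)
  moreover have "matrix_inv (mat 1 :: real^'q^'q) = mat 1" by (rule matrix_inv_eqI) simp
  ultimately show ?thesis by (simp add: gauss_pdf_def quad mult.left_commute mult.assoc[symmetric])
qed

section \<open>The standard Gaussian measure and its moments\<close>

definition std_gauss :: "(real^'q) measure" where
  "std_gauss = density lborel (gauss_pdf 0 (mat 1))"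

lemma sets_std_gauss [measurable_cong, simp]: "sets std_gauss = sets borel"
  by (simp add: std_gauss_def)

lemma space_std_gauss [simp]: "space std_gauss = UNIV"
  by (simp add: std_gauss_def)

text \<open>\<open>T\<close> ranges over all invertible roots. Two roots of one covariance therefore
  push the standard Gaussian to the same law, which is the source of both symmetry arguments below:
  \<open>std_gauss_reflect\<close> and the sign flip in
  \<open>bayes_estimator_optimal\<close>.\<close>

lemma density_gauss_pdf:
  fixes T :: "real^'q^'q"
  assumes T: "invertible T"
  shows "density lborel (gauss_pdf m (T ** transpose T)) = distr std_gauss borel (\<lambda>u. m + T *v u)"
proof (rule measure_eqI)
  fix A assume "A \<in> sets (density lborel (\<lambda>x. ennreal (gauss_pdf m (T ** transpose T) x)))"
  then have A[measurable]: "A \<in> sets borel" by simp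
  have nz: "det T \<noteq> 0" using T by (simp add: invertible_det_nz)
  let ?g = "gauss_pdf m (T ** transpose T)"
  have shift: "(\<integral>\<^sup>+ x. h (m + x) \<partial>lborel) = (\<integral>\<^sup>+ x. h x \<partial>lborel)"
    if [measurable]: "h \<in> borel_measurable borel" for h :: "real^'q \<Rightarrow> ennreal"
    by (subst lborel_distr_plus[symmetric, of m]) (simp add: nn_integral_distr add.commute)
  have "emeasure (density lborel ?g) A = (\<integral>\<^sup>+ z. ennreal (?g z) * indicator A z \<partial>lborel)"
    by (simp add: emeasure_density)
  also have "\<dots> = (\<integral>\<^sup>+ z. ennreal (?g (m + z)) * indicator A (m + z) \<partial>lborel)"
    by (rule shift[symmetric]) measurable
  also have "\<dots> = ennreal \<bar>det T\<bar> * (\<integral>\<^sup>+ u. ennreal (?g (m + T *v u)) * indicator A (m + T *v u) \<partial>lborel)"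
    by (rule nn_integral_lborel_linear[OF nz, symmetric]) measurable
  also have "\<dots> = (\<integral>\<^sup>+ u. ennreal (\<bar>det T\<bar> * ?g (m + T *v u)) * indicator A (m + T *v u) \<partial>lborel)"
    by (subst nn_integral_cmult[symmetric]) (auto simp: ennreal_mult gauss_pdf_nonneg mult.assoc)
  also have "\<dots> = (\<integral>\<^sup>+ u. ennreal (gauss_pdf 0 (mat 1) u) * indicator ((\<lambda>u. m + T *v u) -` A) u \<partial>lborel)"
    by (simp add: gauss_pdf_affine[OF T] indicator_def)
  also have "\<dots> = emeasure (distr std_gauss borel (\<lambda>u. m + T *v u)) A"
  proof -
    have "(\<lambda>u. m + T *v u) -` A \<in> sets borel"
      using measurable_sets[of "\<lambda>u. m + T *v u" borel borel A] by simp
    then show ?thesis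
      by (simp add: emeasure_distr std_gauss_def emeasure_density)
  qed
  finally show "emeasure (density lborel ?g) A = emeasure (distr std_gauss borel (\<lambda>u. m + T *v u)) A" .
qed simp

lemma has_bochner_integral_gauss_pdf:
  fixes T :: "real^'q^'q" and h :: "real^'q \<Rightarrow> 'b::{banach, second_countable_topology}"
  assumes T: "invertible T" and K: "K = T ** transpose T" and [measurable]: "h \<in> borel_measurable borel"
    and int: "has_bochner_integral std_gauss (\<lambda>u. h (m + T *v u)) x"
  shows "has_bochner_integral lborel (\<lambda>z. gauss_pdf m K z *\<^sub>R h z) x"
proof -
  have "has_bochner_integral (distr std_gauss borel (\<lambda>u. m + T *v u)) h x"
    using int by (simp add: has_bochner_integral_iff integrable_distr_eq integral_distr)
  then show ?thesis
    unfolding K density_gauss_pdf[OF T, symmetric]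
    by (simp add: has_bochner_integral_iff integrable_density integral_density gauss_pdf_nonneg)
qed

lemma std_gauss_prod:
  fixes h :: "'q::finite \<Rightarrow> real \<Rightarrow> ennreal"
  assumes [measurable]: "\<And>i. h i \<in> borel_measurable borel"
  shows "(\<integral>\<^sup>+ u. (\<Prod>i\<in>UNIV. h i (u $ i)) \<partial>(std_gauss :: (real^'q) measure))
    = (\<Prod>i\<in>UNIV. \<integral>\<^sup>+ x. ennreal (std_normal_density x) * h i x \<partial>lborel)"
proof -
  have pdf: "gauss_pdf 0 (mat 1) u = (\<Prod>i\<in>UNIV. std_normal_density (u $ i))" for u :: "real^'q"
  proof -
    have "matrix_inv (mat 1 :: real^'q^'q) = mat 1" by (rule matrix_inv_eqI) simp
    moreover have "(2 * pi) powr (- real CARD('q) / 2) = (1 / sqrt (2 * pi)) ^ CARD('q)"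
      by (simp add: powr_half_sqrt[symmetric] powr_minus_divide powr_powr power_one_over flip: powr_realpow)
    moreover have "exp (- (1/2) * (u \<bullet> u)) = (\<Prod>i\<in>UNIV. exp (- (u $ i)\<^sup>2 / 2))"
      by (simp add: inner_vec_def sum_distrib_left sum_negf[symmetric] power2_eq_square flip: exp_sum)
    ultimately show ?thesis
      by (simp add: gauss_pdf_def std_normal_density_def prod_dividef power_one_over)
  qed
  \<comment> \<open>The product rule for \<open>lborel\<close> is indexed by basis vectors; the
    definite description recovers the coordinate index from \<open>axis i 1\<close>.\<close>
  have *: "ennreal (gauss_pdf 0 (mat 1) u) * (\<Prod>i\<in>UNIV. h i (u $ i))
      = (\<Prod>b\<in>Basis. ennreal (std_normal_density (u \<bullet> b)) * h (THE i. b = axis i 1) (u \<bullet> b))"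
    for u :: "real^'q"
    unfolding prod_Basis_vec pdf by (simp add: inner_axis axis_eq_axis prod.distrib prod_ennreal)
  have "(\<integral>\<^sup>+ u. (\<Prod>i\<in>UNIV. h i (u $ i)) \<partial>(std_gauss :: (real^'q) measure))
    = (\<integral>\<^sup>+ u. (\<Prod>b\<in>Basis. ennreal (std_normal_density (u \<bullet> b)) * h (THE i. b = axis i 1) (u \<bullet> b))
        \<partial>(lborel :: (real^'q) measure))"
    unfolding std_gauss_def by (subst nn_integral_density) (simp_all add: *)
  also have "\<dots> = (\<Prod>i\<in>UNIV. \<integral>\<^sup>+ x. ennreal (std_normal_density x) * h i x \<partial>lborel)"
    by (subst nn_integral_lborel_prod) (auto simp: prod_Basis_vec axis_eq_axis)
  finally show ?thesis .
qed

lemma std_gauss_total: "emeasure (std_gauss :: (real^'q) measure) UNIV = 1"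
proof -
  have "(\<integral>\<^sup>+ x. ennreal (std_normal_density x) \<partial>lborel) = 1"
    using prob_space.emeasure_space_1[OF prob_space_normal_density[of 1 0]] by (simp add: emeasure_density)
  then show ?thesis
    using std_gauss_prod[of "\<lambda>(i::'q) x. 1"] by simp
qed

lemma std_gauss_second_moment:
  "has_bochner_integral std_gauss (\<lambda>u::real^'q. (u $ k)\<^sup>2) 1"
proof -
  have 1: "(\<integral>\<^sup>+ x. ennreal (std_normal_density x) \<partial>lborel) = 1"
    using prob_space.emeasure_space_1[OF prob_space_normal_density[of 1 0]] by (simp add: emeasure_density)
  have 2: "(\<integral>\<^sup>+ x. ennreal (std_normal_density x) * ennreal (x\<^sup>2) \<partial>lborel) = 1"
  proof -
    have "has_bochner_integral lborel (\<lambda>x. std_normal_density x * x\<^sup>2) 1"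
      using std_normal_moment_even[of 1] by (simp add: fact_numeral)
    then show ?thesis
      by (subst (asm) has_bochner_integral_iff)
        (simp add: nn_integral_eq_integral flip: ennreal_mult')
  qed
  have "(\<integral>\<^sup>+ x. ennreal (std_normal_density x) * (if i = k then ennreal (x\<^sup>2) else 1) \<partial>lborel) = 1" for i
    using 1 2 by (cases "i = k") auto
  then have "(\<integral>\<^sup>+ u. (\<Prod>i\<in>UNIV. if i = k then ennreal ((u $ i)\<^sup>2) else 1) \<partial>(std_gauss :: (real^'q) measure)) = 1"
    by (subst std_gauss_prod[where h = "\<lambda>i x. if i = k then ennreal (x\<^sup>2) else 1"]) simp_all
  then have "(\<integral>\<^sup>+ u. ennreal ((u $ k)\<^sup>2) \<partial>(std_gauss :: (real^'q) measure)) = ennreal 1"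
    by simp
  then show ?thesis by (intro has_bochner_integral_nn_integral) auto
qed

lemma std_gauss_reflect:
  "distr std_gauss borel (\<lambda>u::real^'q. \<chi> i. if i = k then - u $ i else u $ i) = std_gauss"
proof -
  let ?T = "diag_mat (\<chi> i. if i = k then - 1 else 1) :: real^'q^'q"
  have TT: "?T ** transpose ?T = mat 1"
    by (auto simp: transpose_diag_mat diag_mat_mult if_distrib simp flip: diag_mat_1 cong: if_cong)
  have "0 + ?T *v u = (\<chi> i. if i = k then - u $ i else u $ i)" for u
    by (simp add: vec_eq_iff diag_mat_vec)
  then show ?thesis
    using density_gauss_pdf[OF matrix_inv_eqI(2)[OF TT], of 0] unfolding TT
    by (simp add: std_gauss_def)
qed

text \<open>Reflecting one coordinate preserves the measure and negates the integrand, so the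
  integral equals its own negative. The first moments and the mixed second moments vanish in this
  way without being computed.\<close>

lemma std_gauss_odd:
  fixes h :: "real^'q \<Rightarrow> real"
  assumes int: "integrable std_gauss h" and "\<And>u. h (\<chi> i. if i = k then - u $ i else u $ i) = - h u"
  shows "has_bochner_integral std_gauss h 0"
proof -
  have [measurable]: "h \<in> borel_measurable borel" using int by auto
  have [measurable]: "(\<lambda>u::real^'q. \<chi> i. if i = k then - u $ i else u $ i) \<in> borel_measurable borel"
  proof (intro borel_measurable_continuous_onI continuous_on_vec_lambda)
    show "continuous_on UNIV (\<lambda>u::real^'q. if i = k then - u $ i else u $ i)" for i
      by (cases "i = k") (auto intro!: continuous_intros)
  qed
  have "(\<integral>u. h u \<partial>std_gauss) = (\<integral>u. h u \<partial>distr std_gauss borel (\<lambda>u::real^'q. \<chi> i. if i = k then - u $ i else u $ i))"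
    by (simp add: std_gauss_reflect)
  also have "\<dots> = (\<integral>u. - h u \<partial>std_gauss)" by (simp add: integral_distr assms)
  finally show ?thesis using int by (simp add: has_bochner_integral_iff)
qed

lemma std_gauss_const:
  "has_bochner_integral (std_gauss :: (real^'q) measure) (\<lambda>u. c :: 'b::{banach,second_countable_topology}) c"
  using has_bochner_integral_indicator[of UNIV "std_gauss :: (real^'q) measure" c]
  by (simp add: std_gauss_total measure_def)

lemma std_gauss_mean: "has_bochner_integral std_gauss (\<lambda>u::real^'q. u) 0"
proof (rule has_bochner_integral_vec)
  fix k
  have "integrable std_gauss (\<lambda>u::real^'q. 1 + (u $ k)\<^sup>2)"
    using has_bochner_integral_add[OF std_gauss_const[of 1] std_gauss_second_moment[of k]]
    by (simp add: has_bochner_integral_iff)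
  then have "integrable std_gauss (\<lambda>u::real^'q. u $ k)"
  proof (rule Bochner_Integration.integrable_bound)
    have "\<bar>x\<bar> \<le> 1 + x\<^sup>2" for x :: real
      using sum_squares_bound[of "\<bar>x\<bar>" 1] by simp
    then show "AE u in std_gauss. norm (u $ k) \<le> norm (1 + (u $ k)\<^sup>2)" by simp
  qed simp
  then show "has_bochner_integral std_gauss (\<lambda>u::real^'q. u $ k) (0 $ k)"
    by (simp, intro std_gauss_odd[where k = k]) auto
qed

lemma std_gauss_covariance: "has_bochner_integral std_gauss (\<lambda>u::real^'q. outer u) (mat 1)"
proof (intro has_bochner_integral_vec)
  fix i j
  show "has_bochner_integral std_gauss (\<lambda>u::real^'q. outer u $ i $ j) (mat 1 $ i $ j)"
  proof (cases "i = j")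
    case True
    then show ?thesis using std_gauss_second_moment[of i]
      by (simp add: outer_def mat_def power2_eq_square)
  next
    case False
    have "integrable std_gauss (\<lambda>u::real^'q. (u $ i)\<^sup>2 + (u $ j)\<^sup>2)"
      using has_bochner_integral_add[OF std_gauss_second_moment[of i] std_gauss_second_moment[of j]]
      by (simp add: has_bochner_integral_iff)
    then have "integrable std_gauss (\<lambda>u::real^'q. u $ i * u $ j)"
    proof (rule Bochner_Integration.integrable_bound)
      have "\<bar>x * y\<bar> \<le> x\<^sup>2 + y\<^sup>2" for x y :: real
        using sum_squares_bound[of "\<bar>x\<bar>" "\<bar>y\<bar>"] abs_ge_zero[of "x * y"]
        unfolding abs_mult power2_abs by linarith
      then show "AE u in std_gauss. norm (u $ i * u $ j) \<le> norm ((u $ i)\<^sup>2 + (u $ j)\<^sup>2)" by simp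
    qed simp
    then show ?thesis using False
      by (simp add: outer_def mat_def, intro std_gauss_odd[where k = i]) auto
  qed
qed

lemma outer_matrix_vector_mult: "outer (B *v u) = B ** outer u ** transpose B"
  by (simp add: vec_eq_iff outer_def matrix_matrix_mult_def matrix_vector_mult_def transpose_def
      sum_product sum_distrib_left sum_distrib_right mult_ac)

lemma trace_outer: "trace (outer u) = u \<bullet> u"
  by (simp add: trace_def outer_def inner_vec_def)

lemma borel_measurable_outer [measurable]: "outer \<in> borel_measurable borel"
  unfolding outer_def[abs_def] by (intro borel_measurable_continuous_onI continuous_intros)

lemma gauss_pdf_mean:
  fixes K :: "real^'q^'q" and B :: "real^'q^'r"
  assumes "pos_def K"
  shows "has_bochner_integral lborel (\<lambda>z. gauss_pdf m K z *\<^sub>R (B *v (z - m))) 0"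
proof -
  obtain T :: "real^'q^'q" where T: "K = T ** transpose T" "invertible T"
    using pos_def_sqrt[OF assms] by blast
  have "has_bochner_integral std_gauss (\<lambda>u. (B ** T) *v u) ((B ** T) *v 0)"
    by (rule has_bochner_integral_bounded_linear[OF matrix_vector_mul_bounded_linear std_gauss_mean])
  then show ?thesis
    by (intro has_bochner_integral_gauss_pdf[OF T(2,1)]) (auto simp: matrix_vector_mul_assoc)
qed

lemma bounded_linear_matrix_conj: "bounded_linear (\<lambda>X. (B :: real^'q^'r) ** X ** transpose B)"
proof -
  have "linear (\<lambda>X. B ** X ** transpose B)"
    by (rule linearI) (simp_all add: matrix_add_ldistrib matrix_add_rdistrib matrix_mult_scaleR)
  then show ?thesis by (simp add: linear_conv_bounded_linear)
qed

lemma gauss_pdf_covariance: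
  fixes K :: "real^'q^'q" and B :: "real^'q^'r"
  assumes "pos_def K"
  shows "has_bochner_integral lborel (\<lambda>z. gauss_pdf m K z *\<^sub>R outer (B *v (z - m))) (B ** K ** transpose B)"
proof -
  obtain T :: "real^'q^'q" where T: "K = T ** transpose T" "invertible T"
    using pos_def_sqrt[OF assms] by blast
  have "has_bochner_integral std_gauss (\<lambda>u. (B ** T) ** outer u ** transpose (B ** T)) ((B ** T) ** mat 1 ** transpose (B ** T))"
    by (rule has_bochner_integral_bounded_linear[OF bounded_linear_matrix_conj std_gauss_covariance])
  moreover have "(B ** T) ** mat 1 ** transpose (B ** T) = B ** K ** transpose B"
    by (simp add: T matrix_transpose_mul matrix_mul_assoc)
  ultimately show ?thesis
    by (intro has_bochner_integral_gauss_pdf[OF T(2,1)])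
      (auto simp: matrix_vector_mul_assoc simp flip: outer_matrix_vector_mult)
qed

lemma gauss_pdf_total:
  fixes K :: "real^'q^'q" and c :: "'b::{banach,second_countable_topology}"
  assumes "pos_def K"
  shows "has_bochner_integral lborel (\<lambda>z. gauss_pdf m K z *\<^sub>R c) c"
proof -
  obtain T :: "real^'q^'q" where T: "K = T ** transpose T" "invertible T"
    using pos_def_sqrt[OF assms] by blast
  show ?thesis
    by (intro has_bochner_integral_gauss_pdf[OF T(2,1)] std_gauss_const) simp
qed

lemma bounded_linear_trace: "bounded_linear (trace :: real^'n^'n \<Rightarrow> real)"
proof -
  have "linear (trace :: real^'n^'n \<Rightarrow> real)"
    by (rule linearI) (simp_all add: trace_def sum.distrib sum_distrib_left)
  then show ?thesis by (simp add: linear_conv_bounded_linear)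
qed

text \<open>Bias plus variance: the cross term integrates to 0, and the quadratic term gives the
  trace of a covariance. It serves twice, for the risk of the affine estimator on the whole ball and
  for its square integrability.\<close>

lemma gauss_pdf_norm_square:
  fixes K :: "real^'q^'q" and B :: "real^'q^'r"
  assumes K: "pos_def K"
  shows "(\<integral>\<^sup>+ z. ennreal (gauss_pdf m K z) * ennreal ((norm (a + B *v (z - m)))\<^sup>2) \<partial>lborel)
    = ennreal (a \<bullet> a + trace (B ** K ** transpose B))"
proof -
  have "has_bochner_integral lborel
      (\<lambda>z. gauss_pdf m K z *\<^sub>R (a \<bullet> a) + 2 * (a \<bullet> (gauss_pdf m K z *\<^sub>R (B *v (z - m))))
        + trace (gauss_pdf m K z *\<^sub>R outer (B *v (z - m))))
      (a \<bullet> a + 2 * (a \<bullet> 0) + trace (B ** K ** transpose B))"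
    by (intro has_bochner_integral_add gauss_pdf_total[OF K] has_bochner_integral_mult_right
        has_bochner_integral_inner_right gauss_pdf_mean[OF K]
        has_bochner_integral_bounded_linear[OF bounded_linear_trace] gauss_pdf_covariance[OF K])
  moreover have "gauss_pdf m K z *\<^sub>R (a \<bullet> a) + 2 * (a \<bullet> (gauss_pdf m K z *\<^sub>R (B *v (z - m))))
        + trace (gauss_pdf m K z *\<^sub>R outer (B *v (z - m))) = gauss_pdf m K z * (norm (a + B *v (z - m)))\<^sup>2" for z
  proof -
    have "r *\<^sub>R (a \<bullet> a) + 2 * (a \<bullet> (r *\<^sub>R y)) + trace (r *\<^sub>R outer y) = r * (norm (a + y))\<^sup>2"
      for r and y :: "real^'r"
      by (simp only: linear_cmul[OF bounded_linear.linear[OF bounded_linear_trace]] trace_outer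
        power2_norm_eq_inner inner_add_left inner_add_right inner_commute[of y a] inner_scaleR_right
        real_scaleR_def distrib_left mult.left_commute)
    then show ?thesis .
  qed
  ultimately have *: "has_bochner_integral lborel (\<lambda>z. gauss_pdf m K z * (norm (a + B *v (z - m)))\<^sup>2)
      (a \<bullet> a + trace (B ** K ** transpose B))" by simp
  have "(\<integral>\<^sup>+ z. ennreal (gauss_pdf m K z) * ennreal ((norm (a + B *v (z - m)))\<^sup>2) \<partial>lborel)
    = (\<integral>\<^sup>+ z. ennreal (gauss_pdf m K z * (norm (a + B *v (z - m)))\<^sup>2) \<partial>lborel)"
    by (simp add: ennreal_mult gauss_pdf_nonneg)
  also have "\<dots> = ennreal (\<integral> z. gauss_pdf m K z * (norm (a + B *v (z - m)))\<^sup>2 \<partial>lborel)"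
    using * by (intro nn_integral_eq_integral) (auto simp: has_bochner_integral_iff gauss_pdf_nonneg)
  finally show ?thesis using * by (simp add: has_bochner_integral_iff)
qed

subsection \<open>Block matrices and the divergence\<close>

lemma sum_UNIV_Plus:
  "(\<Sum>a\<in>(UNIV :: ('n::finite + 'p::finite) set). f a) = (\<Sum>i\<in>UNIV. f (Inl i)) + (\<Sum>j\<in>UNIV. f (Inr j))"
  by (subst UNIV_Plus_UNIV[symmetric], subst sum.Plus) auto

definition blk_vec :: "real^'n \<Rightarrow> real^'p \<Rightarrow> real^('n::finite + 'p::finite)" where
  "blk_vec x y = (\<chi> a. case a of Inl i \<Rightarrow> x $ i | Inr j \<Rightarrow> y $ j)"

definition blk_row :: "real^'n^'r \<Rightarrow> real^'p^'r \<Rightarrow> real^('n::finite + 'p::finite)^'r" where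
  "blk_row A B = (\<chi> i. blk_vec (A $ i) (B $ i))"

definition blk_mat :: "real^'n^'n \<Rightarrow> real^'p^'n \<Rightarrow> real^'n^'p \<Rightarrow> real^'p^'p
    \<Rightarrow> real^('n::finite + 'p::finite)^('n + 'p)" where
  "blk_mat A B C D = (\<chi> a. case a of Inl i \<Rightarrow> blk_vec (A $ i) (B $ i) | Inr j \<Rightarrow> blk_vec (C $ j) (D $ j))"

lemma blk_vec_nth [simp]: "blk_vec x y $ Inl i = x $ i" "blk_vec x y $ Inr j = y $ j"
  by (simp_all add: blk_vec_def)

lemma blk_mat_nth [simp]:
  "blk_mat A B C D $ Inl i = blk_vec (A $ i) (B $ i)" "blk_mat A B C D $ Inr j = blk_vec (C $ j) (D $ j)"
  by (simp_all add: blk_mat_def)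

lemma blk_row_nth [simp]: "blk_row A B $ i = blk_vec (A $ i) (B $ i)"
  by (simp add: blk_row_def)

lemma xpart_nth [simp]: "xpart z $ i = z $ Inl i"
  by (simp add: xpart_def)

lemma ypart_nth [simp]: "ypart z $ i = z $ Inr i"
  by (simp add: ypart_def)

lemma vec_sum_eq_iff: "(u :: 'b^('n::finite + 'p::finite)) = v \<longleftrightarrow> (\<forall>i. u $ Inl i = v $ Inl i) \<and> (\<forall>j. u $ Inr j = v $ Inr j)"
  unfolding vec_eq_iff by (auto simp: split_sum_all)

lemma blk_mat_mult:
  "blk_mat A B C D ** blk_mat A' B' C' D'
    = blk_mat (A ** A' + B ** C') (A ** B' + B ** D') (C ** A' + D ** C') (C ** B' + D ** D')"
  by (simp add: vec_sum_eq_iff matrix_matrix_mult_def sum_UNIV_Plus)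

lemma blk_row_mult:
  "blk_row A B ** blk_mat A' B' C' D' = blk_row (A ** A' + B ** C') (A ** B' + B ** D')"
  by (subst vec_eq_iff) (simp add: vec_sum_eq_iff matrix_matrix_mult_def sum_UNIV_Plus)

lemma blk_row_mult_transpose:
  "blk_row A B ** transpose (blk_row A' B') = A ** transpose A' + B ** transpose B'"
  by (simp add: vec_eq_iff matrix_matrix_mult_def transpose_def sum_UNIV_Plus)

lemma transpose_blk_mat:
  "transpose (blk_mat A B C D) = blk_mat (transpose A) (transpose C) (transpose B) (transpose D)"
  by (simp add: vec_sum_eq_iff transpose_def)

lemma blk_row_vec: "blk_row A B *v z = A *v xpart z + B *v ypart z"
  by (simp add: vec_eq_iff matrix_vector_mult_def sum_UNIV_Plus)

lemma xpart_blk_mat: "xpart (blk_mat A B C D *v z) = A *v xpart z + B *v ypart z"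
  by (simp add: vec_eq_iff matrix_vector_mult_def sum_UNIV_Plus)

lemma ypart_blk_mat: "ypart (blk_mat A B C D *v z) = C *v xpart z + D *v ypart z"
  by (simp add: vec_eq_iff matrix_vector_mult_def sum_UNIV_Plus)

lemma xpart_transpose_blk_row: "xpart (transpose (blk_row A B) *v v) = transpose A *v v"
  by (simp add: vec_eq_iff matrix_vector_mult_def transpose_def)

lemma ypart_transpose_blk_row: "ypart (transpose (blk_row A B) *v v) = transpose B *v v"
  by (simp add: vec_eq_iff matrix_vector_mult_def transpose_def)

lemma blk_mat_blks: "blk_mat (blk_xx K) (blk_xy K) (blk_yx K) (blk_yy K) = K"
  by (simp add: vec_sum_eq_iff blk_xx_def blk_xy_def blk_yx_def blk_yy_def)

lemma replace_xx_eq: "replace_xx A K = blk_mat A (blk_xy K) (blk_yx K) (blk_yy K)"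
  by (simp add: vec_sum_eq_iff replace_xx_def blk_xy_def blk_yx_def blk_yy_def)

lemma blk_mat_diag: "blk_mat (diag_mat d) 0 0 (diag_mat e) = diag_mat (blk_vec d e)"
  by (simp add: vec_sum_eq_iff diag_mat_def)

lemma blk_mat_1: "blk_mat (mat 1) 0 0 (mat 1) = mat 1"
  by (simp add: vec_sum_eq_iff mat_def)

lemma xpart_add: "xpart (a + b) = xpart a + xpart b" and ypart_add: "ypart (a + b) = ypart a + ypart b"
  and xpart_diff: "xpart (a - b) = xpart a - xpart b" and ypart_diff: "ypart (a - b) = ypart a - ypart b"
  and xpart_0: "xpart 0 = 0" and ypart_0: "ypart 0 = 0"
  by (simp_all add: vec_eq_iff)

lemma borel_measurable_xpart [measurable]: "xpart \<in> borel_measurable borel"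
  unfolding xpart_def[abs_def] by (intro borel_measurable_continuous_onI continuous_intros)

lemma borel_measurable_ypart [measurable]: "ypart \<in> borel_measurable borel"
  unfolding ypart_def[abs_def] by (intro borel_measurable_continuous_onI continuous_intros)

lemma pos_def_conj:
  fixes K :: "real^'q^'q" and B :: "real^'q^'r"
  assumes K: "pos_def K" and B: "\<And>v. transpose B *v v = 0 \<Longrightarrow> v = 0"
  shows "pos_def (B ** K ** transpose B)"
  unfolding pos_def_def
proof (intro conjI allI impI)
  show "transpose (B ** K ** transpose B) = B ** K ** transpose B"
    using K by (simp add: matrix_transpose_mul pos_def_def matrix_mul_assoc)
  fix v :: "real^'r" assume "v \<noteq> 0"
  then have "transpose B *v v \<noteq> 0" using B by blast
  then have "0 < (transpose B *v v) \<bullet> (K *v (transpose B *v v))" using K unfolding pos_def_def by blast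
  also have "\<dots> = (v v* B) \<bullet> (K *v (transpose B *v v))" by simp
  also have "\<dots> = v \<bullet> ((B ** K ** transpose B) *v v)"
    unfolding dot_lmul_matrix by (simp only: matrix_vector_mul_assoc matrix_mul_assoc)
  finally show "0 < v \<bullet> ((B ** K ** transpose B) *v v)" .
qed

section \<open>The divergence as a sum over eigenvalues, and Lagrangian duality\<close>

lemma trace_scaleR: "trace (r *\<^sub>R (A :: real^'n^'n)) = r * trace A"
  by (simp add: trace_def sum_distrib_left)

lemma trace_uminus: "trace (- (A :: real^'n^'n)) = - trace A"
  by (simp add: trace_def sum_negf)

text \<open>Whichever root \<open>L\<close> the definition picks, \<open>M\<close> is conjugate by
  \<open>L\<close> to \<open>Kt ** matrix_inv K\<close>. So a single diagonalisation of this
  product, by a possibly non-orthogonal matrix, turns the traces in all three cases into sums over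
  the same eigenvalues.\<close>

lemma tau_div_eigenvalues:
  fixes K Kt Q :: "real^'q^'q"
  assumes \<tau>: "0 \<le> \<tau>" "\<tau> \<le> 1" and K: "pos_def K" and Q: "invertible Q"
    and R: "Kt ** matrix_inv K = Q ** diag_mat \<mu> ** matrix_inv Q"
  shows "tau_div \<tau> mt Kt m K = (if \<tau> < 1
      then ereal (1 / (1 - \<tau>) * wnorm2 (mt - m) (matrix_inv K) + (\<Sum>i\<in>UNIV. tau_fun \<tau> (\<mu> $ i)))
      else if mt = m then ereal (\<Sum>i\<in>UNIV. tau_fun \<tau> (\<mu> $ i)) else \<infinity>)"
proof -
  define L :: "real^'q^'q" where "L = (SOME L. K = L ** transpose L)"
  obtain L' :: "real^'q^'q" where "K = L' ** transpose L'" using pos_def_sqrt[OF K] by blast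
  then have KL: "K = L ** transpose L" unfolding L_def by (rule someI)
  then have L: "invertible L" using K mult_transpose_invertible by blast
  define M where "M = matrix_inv L ** Kt ** transpose (matrix_inv L)"
  define Q' where "Q' = matrix_inv L ** Q"
  have Q': "invertible Q'" using L Q by (simp add: Q'_def invertible_mult invertible_matrix_inv)
  have Ki: "matrix_inv K = transpose (matrix_inv L) ** matrix_inv L"
    unfolding KL by (simp add: matrix_inv_mult L invertible_transpose matrix_inv_transpose)
  have "M = matrix_inv L ** (Kt ** matrix_inv K) ** L"
    unfolding Ki M_def by (simp add: invertible_inv[OF L] flip: matrix_mul_assoc)
  also have "\<dots> = Q' ** diag_mat \<mu> ** matrix_inv Q'"
    unfolding R Q'_def by (simp add: matrix_inv_mult invertible_matrix_inv matrix_inv_inv L Q matrix_mul_assoc)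
  finally have M: "M = Q' ** diag_mat \<mu> ** matrix_inv Q'" .
  have tR: "trace (Kt ** matrix_inv K) = (\<Sum>i\<in>UNIV. \<mu> $ i)"
    unfolding R by (simp add: trace_conj Q trace_diag_mat)
  have tlogR: "trace (mat_log (Kt ** matrix_inv K)) = (\<Sum>i\<in>UNIV. ln (\<mu> $ i))"
    unfolding R mat_log_def by (simp add: mat_fun_eq trace_conj Q trace_diag_mat)
  have tpow: "trace (mat_pow M \<tau>) = (\<Sum>i\<in>UNIV. \<mu> $ i powr \<tau>)"
    unfolding M mat_pow_def by (simp add: mat_fun_eq trace_conj Q' trace_diag_mat)
  have "M ** mat_log M = Q' ** diag_mat (\<chi> i. \<mu> $ i * ln (\<mu> $ i)) ** matrix_inv Q'"
  proof -
    have "M ** mat_log M = Q' ** diag_mat \<mu> ** (matrix_inv Q' ** Q') ** diag_mat (\<chi> i. ln (\<mu> $ i)) ** matrix_inv Q'"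
      unfolding M mat_log_def mat_fun_eq[OF Q'] by (simp add: matrix_mul_assoc)
    also have "\<dots> = Q' ** (diag_mat \<mu> ** diag_mat (\<chi> i. ln (\<mu> $ i))) ** matrix_inv Q'"
      by (simp add: invertible_inv[OF Q'] matrix_mul_assoc)
    finally show ?thesis by (simp add: diag_mat_mult)
  qed
  then have tlog: "trace (M ** mat_log M) = (\<Sum>i\<in>UNIV. \<mu> $ i * ln (\<mu> $ i))"
    by (simp add: trace_conj Q' trace_diag_mat)
  have tI: "trace (mat 1 :: real^'q^'q) = (\<Sum>i\<in>(UNIV :: 'q set). 1)" by (simp add: trace_I)
  note td = tau_div_def Let_def L_def[symmetric] M_def[symmetric]
  consider "\<tau> = 0" | "0 < \<tau>" "\<tau> < 1" | "\<tau> = 1" using \<tau> by linarith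
  then show ?thesis
  proof cases
    case 1
    then have "(\<Sum>i\<in>UNIV. tau_fun \<tau> (\<mu> $ i)) = trace (- mat_log (Kt ** matrix_inv K) + Kt ** matrix_inv K - mat 1)"
      by (simp only: trace_add trace_sub trace_uminus tR tlogR tI)
        (simp add: tau_fun_def sum.distrib sum_subtractf)
    then show ?thesis using 1 by (simp add: td)
  next
    case 2
    then have "(\<Sum>i\<in>UNIV. tau_fun \<tau> (\<mu> $ i)) = trace ((1 / (\<tau> * (\<tau> - 1))) *\<^sub>R mat_pow M \<tau>
        + (1 / (1 - \<tau>)) *\<^sub>R (Kt ** matrix_inv K) + (1 / \<tau>) *\<^sub>R mat 1)"
      by (simp only: trace_add trace_scaleR tR tpow tI)
        (simp add: tau_fun_def sum.distrib sum_divide_distrib)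
    then show ?thesis using 2 by (simp add: td)
  next
    case 3
    then have "(\<Sum>i\<in>UNIV. tau_fun \<tau> (\<mu> $ i)) = trace (M ** mat_log M - Kt ** matrix_inv K + mat 1)"
      by (simp only: trace_add trace_sub tR tlog tI)
        (simp add: tau_fun_def sum.distrib sum_subtractf)
    then show ?thesis using 3 by (simp add: td)
  qed
qed

lemma conj_mult_matrix_inv:
  fixes T V :: "real^'q^'q"
  assumes T: "invertible T" and V: "orthogonal_matrix V"
  shows "(T ** (V ** diag_mat \<mu> ** transpose V) ** transpose T) ** matrix_inv (T ** transpose T)
    = (T ** V) ** diag_mat \<mu> ** matrix_inv (T ** V)" "invertible (T ** V)"
proof -
  have V': "matrix_inv V = transpose V" "invertible V"
    using V by (auto intro: matrix_inv_eqI simp: orthogonal_matrix_def)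
  have "matrix_inv (T ** transpose T) = matrix_inv (transpose T) ** matrix_inv T"
    by (simp add: matrix_inv_mult T invertible_transpose)
  then have "(T ** (V ** diag_mat \<mu> ** transpose V) ** transpose T) ** matrix_inv (T ** transpose T)
    = T ** (V ** diag_mat \<mu> ** transpose V) ** (transpose T ** matrix_inv (transpose T)) ** matrix_inv T"
    by (simp add: matrix_mul_assoc)
  then show "(T ** (V ** diag_mat \<mu> ** transpose V) ** transpose T) ** matrix_inv (T ** transpose T)
    = (T ** V) ** diag_mat \<mu> ** matrix_inv (T ** V)"
    by (simp add: invertible_inv invertible_transpose T matrix_inv_mult V' matrix_mul_assoc)
  show "invertible (T ** V)" by (simp add: T V' invertible_mult)
qed

lemma tau_div_diag:
  fixes T :: "real^'q^'q"
  assumes \<tau>: "0 \<le> \<tau>" "\<tau> \<le> 1" and T: "invertible T"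
  shows "tau_div \<tau> m (T ** diag_mat d ** transpose T) m (T ** transpose T) = ereal (\<Sum>i\<in>UNIV. tau_fun \<tau> (d $ i))"
proof -
  have "orthogonal_matrix (mat 1 :: real^'q^'q)" by (rule orthogonal_matrix_id)
  from conj_mult_matrix_inv(1)[OF T this, of d]
  show ?thesis
    using tau_div_eigenvalues[OF \<tau> pos_def_mult_transpose[OF T], of T "T ** diag_mat d ** transpose T" d m m] T
    by (simp add: wnorm2_def)
qed

lemma orthogonal_matrix_row_col:
  assumes "orthogonal_matrix (V :: real^'q^'q)"
  shows "(\<Sum>j\<in>UNIV. (V $ i $ j)\<^sup>2) = 1" "(\<Sum>i\<in>UNIV. (V $ i $ j)\<^sup>2) = 1"
proof -
  have "(V ** transpose V) $ i $ i = 1" "(transpose V ** V) $ j $ j = 1"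
    using assms by (simp_all add: orthogonal_matrix_def mat_def)
  then show "(\<Sum>j\<in>UNIV. (V $ i $ j)\<^sup>2) = 1" "(\<Sum>i\<in>UNIV. (V $ i $ j)\<^sup>2) = 1"
    by (simp_all add: matrix_matrix_mult_def transpose_def power2_eq_square)
qed

text \<open>Lagrangian duality: the squared entries of the orthogonal matrix diagonalising
  \<open>T\<^sup>-\<^sup>1 Kt T\<^sup>-\<^sup>T\<close> are doubly stochastic, so the scalar tangent inequality for \<open>tau_fun\<close> can be
  averaged over all pairs (weight, eigenvalue).\<close>
lemma tau_div_saddle_bound:
  fixes T Kt :: "real^'q^'q" and B :: "real^'q^'r" and w :: "real^'q"
  assumes \<tau>: "0 \<le> \<tau>" "\<tau> \<le> 1" and T: "invertible T" and Kt: "pos_def Kt"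
    and w: "transpose (B ** T) ** (B ** T) = diag_mat w"
    and lam: "lam > 0" "\<And>a. (1 - \<tau>) * w $ a < lam"
    and div: "tau_div \<tau> mt Kt m (T ** transpose T) \<le> ereal (\<Sum>a\<in>UNIV. tau_fun \<tau> (tau_inv \<tau> (w $ a / lam)))"
  shows "(B *v (mt - m)) \<bullet> (B *v (mt - m)) + trace (B ** Kt ** transpose B)
    \<le> (\<Sum>a\<in>UNIV. w $ a * tau_inv \<tau> (w $ a / lam))"
proof -
  define M where "M = matrix_inv T ** Kt ** transpose (matrix_inv T)"
  have KtM: "Kt = T ** M ** transpose T"
  proof -
    have "T ** M ** transpose T = (T ** matrix_inv T) ** Kt ** transpose (T ** matrix_inv T)"
      by (simp add: M_def matrix_transpose_mul matrix_mul_assoc)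
    then show ?thesis by (simp add: invertible_inv[OF T] transpose_mat)
  qed
  have "pos_def M" unfolding M_def
  proof (rule pos_def_conj[OF Kt])
    fix v assume "transpose (matrix_inv T) *v v = 0"
    then have "(transpose T ** transpose (matrix_inv T)) *v v = 0"
      by (metis matrix_vector_mul_assoc matrix_vector_mult_0_right)
    then show "v = 0" by (simp add: invertible_inv[OF T] transpose_mat flip: matrix_transpose_mul)
  qed
  then obtain V \<mu> where V: "orthogonal_matrix V" and M: "M = V ** diag_mat \<mu> ** transpose V"
    and \<mu>: "\<And>i. \<mu> $ i > 0"
    using pos_def_diagonalisation by blast
  define v where "v = matrix_inv T *v (mt - m)"
  have Tv: "mt - m = T *v v" by (simp add: v_def matrix_vector_mul_assoc invertible_inv[OF T])
  have wn: "wnorm2 (mt - m) (matrix_inv (T ** transpose T)) = v \<bullet> v"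
  proof -
    have "matrix_inv (T ** transpose T) = transpose (matrix_inv T) ** matrix_inv T"
      by (simp add: matrix_inv_mult T invertible_transpose matrix_inv_transpose)
    then have "wnorm2 (mt - m) (matrix_inv (T ** transpose T)) = (mt - m) \<bullet> (transpose (matrix_inv T) *v v)"
      by (simp add: wnorm2_def v_def matrix_vector_mul_assoc)
    also have "\<dots> = (v v* matrix_inv T) \<bullet> (mt - m)" by (simp add: inner_commute)
    finally show ?thesis by (simp add: dot_lmul_matrix v_def)
  qed
  define E where "E = (\<Sum>a\<in>UNIV. tau_fun \<tau> (\<mu> $ a))"
  define c where "c = (\<Sum>a\<in>UNIV. tau_fun \<tau> (tau_inv \<tau> (w $ a / lam)))"
  have td: "tau_div \<tau> mt Kt m (T ** transpose T) = (if \<tau> < 1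
      then ereal (1 / (1 - \<tau>) * (v \<bullet> v) + E) else if mt = m then ereal E else \<infinity>)"
    unfolding E_def
    using tau_div_eigenvalues[OF \<tau> pos_def_mult_transpose[OF T] conj_mult_matrix_inv(2)[OF T V]
        conj_mult_matrix_inv(1)[OF T V], of mt \<mu> m]
    by (simp add: wn KtM M)
  \<comment> \<open>The divergence constraint multiplied by \<open>lam\<close>. For
    \<open>\<tau> < 1\<close> each weight is below \<open>lam / (1 - \<tau>)\<close>, so a mean
    shift uses up at least as much budget as it gains in risk; for \<open>\<tau> = 1\<close>
    finiteness of the divergence forbids any shift.\<close>
  have mean: "(\<Sum>a\<in>UNIV. w $ a * (v $ a)\<^sup>2) + lam * E \<le> lam * c"
  proof (cases "\<tau> < 1")
    case True
    have "(\<Sum>a\<in>UNIV. w $ a * (v $ a)\<^sup>2) \<le> (\<Sum>a\<in>UNIV. lam / (1 - \<tau>) * (v $ a)\<^sup>2)"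
      using True lam by (intro sum_mono mult_right_mono) (auto simp: field_simps less_imp_le)
    also have "\<dots> = lam * (1 / (1 - \<tau>) * (v \<bullet> v))"
      by (simp add: inner_vec_def power2_eq_square sum_distrib_left)
    finally have "(\<Sum>a\<in>UNIV. w $ a * (v $ a)\<^sup>2) + lam * E \<le> lam * (1 / (1 - \<tau>) * (v \<bullet> v) + E)"
      by (simp add: distrib_left)
    also have "\<dots> \<le> lam * c"
      using div lam True by (intro mult_left_mono) (auto simp: td c_def)
    finally show ?thesis .
  next
    case False
    then have "mt = m" "E \<le> c" using div by (auto simp: td c_def split: if_splits)
    then show ?thesis using lam by (simp add: v_def)
  qed
  have quad: "(B *v (mt - m)) \<bullet> (B *v (mt - m)) = (\<Sum>a\<in>UNIV. w $ a * (v $ a)\<^sup>2)"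
  proof -
    have "(B *v (mt - m)) \<bullet> (B *v (mt - m)) = (v v* transpose (B ** T)) \<bullet> ((B ** T) *v v)"
      by (simp add: Tv matrix_vector_mul_assoc)
    also have "\<dots> = v \<bullet> (diag_mat w *v v)"
      unfolding dot_lmul_matrix by (simp add: matrix_vector_mul_assoc w)
    finally show ?thesis by (simp add: inner_vec_def diag_mat_vec power2_eq_square mult_ac)
  qed
  have tr: "trace (B ** Kt ** transpose B) = (\<Sum>a\<in>UNIV. w $ a * M $ a $ a)"
  proof -
    have "B ** Kt ** transpose B = (B ** T) ** (M ** transpose (B ** T))"
      by (simp add: KtM matrix_transpose_mul matrix_mul_assoc)
    then have "trace (B ** Kt ** transpose B) = trace ((M ** transpose (B ** T)) ** (B ** T))"
      by (simp only: trace_mul_sym[of "B ** T"])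
    then have "trace (B ** Kt ** transpose B) = trace (M ** (transpose (B ** T) ** (B ** T)))"
      by (simp only: matrix_mul_assoc)
    then show ?thesis by (simp add: w trace_def matrix_mult_diag_mat mult.commute)
  qed
  have Maa: "M $ a $ a = (\<Sum>j\<in>UNIV. (V $ a $ j)\<^sup>2 * \<mu> $ j)" for a
    unfolding M by (subst matrix_matrix_mult_def)
      (simp add: matrix_mult_diag_mat transpose_def power2_eq_square mult_ac)
  let ?s = "\<lambda>a. tau_inv \<tau> (w $ a / lam)"
  \<comment> \<open>\<open>?s a\<close> comes from \<open>tau_inv\<close>, so the slope of
    \<open>tau_fun\<close> there is \<open>w $ a / lam\<close>; hence it maximises the scalar
    Lagrangian \<open>w $ a * x - lam * tau_fun \<tau> x\<close> over positive x.\<close>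
  have tangent: "w $ a * \<mu> $ j - lam * tau_fun \<tau> (\<mu> $ j) \<le> w $ a * ?s a - lam * tau_fun \<tau> (?s a)" for a j
  proof -
    have dom: "(1 - \<tau>) * (w $ a / lam) < 1" using lam by (simp add: field_simps)
    have "tau_fun \<tau> (?s a) + w $ a / lam * (\<mu> $ j - ?s a) \<le> tau_fun \<tau> (\<mu> $ j)"
      using tau_fun_tangent[OF \<tau> tau_inv_pos[OF dom] \<mu>] by (simp add: tau_fun'_tau_inv[OF \<tau>(2) dom])
    from mult_left_mono[OF this, of lam] show ?thesis using lam by (simp add: algebra_simps)
  qed
  have "(\<Sum>a\<in>UNIV. w $ a * M $ a $ a) - lam * E
    = (\<Sum>a\<in>UNIV. \<Sum>j\<in>UNIV. (V $ a $ j)\<^sup>2 * (w $ a * \<mu> $ j - lam * tau_fun \<tau> (\<mu> $ j)))"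
  proof -
    have "(\<Sum>a\<in>UNIV. \<Sum>j\<in>UNIV. (V $ a $ j)\<^sup>2 * (lam * tau_fun \<tau> (\<mu> $ j)))
      = (\<Sum>j\<in>UNIV. (\<Sum>a\<in>UNIV. (V $ a $ j)\<^sup>2) * (lam * tau_fun \<tau> (\<mu> $ j)))"
      by (subst sum.swap) (simp add: sum_distrib_right)
    also have "\<dots> = lam * E" by (simp add: orthogonal_matrix_row_col[OF V] E_def sum_distrib_left)
    finally show ?thesis
      by (simp add: right_diff_distrib sum_subtractf Maa sum_distrib_left mult_ac)
  qed
  also have "\<dots> \<le> (\<Sum>a\<in>UNIV. \<Sum>j\<in>UNIV. (V $ a $ j)\<^sup>2 * (w $ a * ?s a - lam * tau_fun \<tau> (?s a)))"
    by (intro sum_mono mult_left_mono tangent) simp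
  also have "\<dots> = (\<Sum>a\<in>UNIV. w $ a * ?s a) - lam * c"
    by (simp add: orthogonal_matrix_row_col[OF V] c_def sum_subtractf sum_distrib_left flip: sum_distrib_right)
  finally show ?thesis using mean unfolding quad tr by linarith
qed

section \<open>Spectral norm and closed form of the perturbed error covariance\<close>

lemma spec_norm_diagonalisation:
  fixes P :: "real^'n^'n"
  assumes U: "orthogonal_matrix U" and P: "P = U ** diag_mat p ** transpose U" and p: "\<And>i. p $ i > 0"
  shows "p $ i \<le> spec_norm P" "\<exists>k. spec_norm P \<le> p $ k"
proof -
  have bl: "bounded_linear ((*v) P)" by simp
  have UU: "transpose U ** U = mat 1" using U by (simp add: orthogonal_matrix_def)
  have nU: "norm (U *v v) = norm v" "norm (transpose U *v v) = norm v" for v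
    using U orthogonal_matrix_transpose[of U]
    by (metis orthogonal_matrix orthogonal_transformation_matrix orthogonal_transformation_norm matrix_of_matrix_vector_mul
        matrix_vector_mul_linear orthogonal_transformation)+
  note nU = nU nU(2)[unfolded transpose_matrix_vector]
  have "P *v (U *v axis i 1) = U *v (diag_mat p *v axis i 1)"
    by (simp add: P matrix_vector_mul_assoc UU flip: matrix_mul_assoc)
  moreover have "diag_mat p *v axis i 1 = p $ i *\<^sub>R axis i 1"
    by (simp add: vec_eq_iff diag_mat_vec axis_def)
  ultimately have "norm (P *v (U *v axis i 1)) = p $ i"
    using p[of i] by (simp add: nU)
  then show "p $ i \<le> spec_norm P"
    using onorm[OF bl, of "U *v axis i 1"] by (simp add: spec_norm_def nU)
  define b where "b = Max (range (\<lambda>i. p $ i))"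
  have b: "p $ i \<le> b" for i by (simp add: b_def)
  have "b \<in> range (\<lambda>i. p $ i)" unfolding b_def by (intro Max_in) auto
  then obtain k where k: "b = p $ k" by auto
  have "norm (P *v v) \<le> b * norm v" for v
  proof -
    let ?u = "transpose U *v v"
    have "norm (P *v v) = norm (diag_mat p *v ?u)"
      by (simp add: P nU flip: matrix_vector_mul_assoc)
    also have "\<dots> \<le> norm (b *\<^sub>R ?u)"
      using b p k by (intro norm_le_componentwise_cart)
        (auto simp: diag_mat_vec abs_mult less_imp_le intro!: mult_right_mono)
    finally show ?thesis using p[of k] k by (simp add: nU)
  qed
  then show "\<exists>k. spec_norm P \<le> p $ k"
    unfolding spec_norm_def using onorm_le[of "(*v) P" b] k by blast
qed

text \<open>\<open>transpose L ** L\<close> is conjugate by \<open>L\<close> to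
  \<open>L ** transpose L\<close>, hence diagonalised by \<open>W = matrix_inv L ** U\<close>, in
  general not orthogonal; this is where it pays off that \<open>mat_fun\<close> admits arbitrary
  similarities. The outer factors \<open>L\<close> and \<open>transpose L\<close> then restore
  \<open>U\<close> and multiply by \<open>p\<close>, so every root \<open>L\<close> gives the same
  matrix.\<close>

lemma Ptilde_formula_diagonalisation:
  fixes L U :: "real^'n^'n"
  assumes U: "orthogonal_matrix U" and P: "L ** transpose L = U ** diag_mat p ** transpose U"
    and L: "invertible L" and \<tau>: "\<tau> \<le> 1"
  shows "Ptilde_formula \<tau> lam L = U ** diag_mat (\<chi> i. p $ i * tau_inv \<tau> (p $ i / lam)) ** transpose U"
proof -
  have U': "matrix_inv U = transpose U" "invertible U" "transpose U ** U = mat 1"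
    using U by (auto intro: matrix_inv_eqI simp: orthogonal_matrix_def)
  define W where "W = matrix_inv L ** U"
  have W: "invertible W" by (simp add: W_def invertible_mult invertible_matrix_inv L U')
  have Wi: "matrix_inv W = transpose U ** L"
    by (simp add: W_def matrix_inv_mult invertible_matrix_inv matrix_inv_inv L U')
  have LW: "L ** W = U" by (simp add: W_def matrix_mul_assoc invertible_inv[OF L])
  have "W ** diag_mat p ** matrix_inv W = matrix_inv L ** (L ** transpose L) ** L"
    unfolding P Wi unfolding W_def by (simp add: matrix_mul_assoc)
  then have LL: "transpose L ** L = W ** diag_mat p ** matrix_inv W"
    by (simp add: matrix_mul_assoc invertible_inv[OF L])
  have scale: "r *\<^sub>R (transpose L ** L) = W ** diag_mat (\<chi> i. r * p $ i) ** matrix_inv W" for r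
  proof -
    have "diag_mat (\<chi> i. r * p $ i) = r *\<^sub>R diag_mat p" by (simp add: vec_eq_iff diag_mat_def)
    then show ?thesis by (simp add: LL matrix_mult_scaleR)
  qed
  have sub: "mat 1 - r *\<^sub>R (transpose L ** L) = W ** diag_mat (\<chi> i. 1 - r * p $ i) ** matrix_inv W" for r
  proof -
    have "diag_mat (\<chi> i. 1 - r * p $ i) + diag_mat (\<chi> i. r * p $ i) = mat 1"
      by (simp add: vec_eq_iff diag_mat_def mat_def)
    then have "W ** diag_mat (\<chi> i. 1 - r * p $ i) ** matrix_inv W + r *\<^sub>R (transpose L ** L) = mat 1"
      unfolding scale by (simp add: invertible_inv[OF W] flip: matrix_add_ldistrib matrix_add_rdistrib)
    then show ?thesis by (simp add: algebra_simps)
  qed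
  have conj: "L ** (W ** diag_mat d ** matrix_inv W) ** transpose L
      = U ** diag_mat (\<chi> i. p $ i * d $ i) ** transpose U" for d
  proof -
    have "L ** (W ** diag_mat d ** matrix_inv W) ** transpose L = (L ** W) ** diag_mat d ** transpose U ** (L ** transpose L)"
      by (simp add: Wi matrix_mul_assoc)
    also have "\<dots> = U ** diag_mat d ** (transpose U ** U) ** diag_mat p ** transpose U"
      unfolding LW P by (simp add: matrix_mul_assoc)
    also have "\<dots> = U ** (diag_mat d ** diag_mat p) ** transpose U"
      by (simp add: U' matrix_mul_assoc)
    finally show ?thesis by (simp add: diag_mat_mult mult.commute)
  qed
  show ?thesis
  proof (cases "\<tau> < 1")
    case True
    then show ?thesis
      by (simp add: Ptilde_formula_def mat_pow_def sub mat_fun_eq[OF W] conj tau_inv_def)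
  next
    case False
    then show ?thesis
      by (simp add: Ptilde_formula_def mat_exp_def scale mat_fun_eq[OF W] conj tau_inv_def)
  qed
qed

subsection \<open>The Bayes estimator\<close>

lemma nn_integral_gauss_pdf:
  fixes T :: "real^'q^'q"
  assumes T: "invertible T" and [measurable]: "h \<in> borel_measurable borel"
  shows "(\<integral>\<^sup>+ z. ennreal (gauss_pdf m (T ** transpose T) z) * h z \<partial>lborel) = (\<integral>\<^sup>+ u. h (m + T *v u) \<partial>std_gauss)"
proof -
  have "(\<integral>\<^sup>+ z. ennreal (gauss_pdf m (T ** transpose T) z) * h z \<partial>lborel)
    = (\<integral>\<^sup>+ z. h z \<partial>density lborel (gauss_pdf m (T ** transpose T)))"
    by (simp add: nn_integral_density)
  then show ?thesis by (simp add: density_gauss_pdf[OF T] nn_integral_distr)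
qed

text \<open>Negating the block \<open>X\<close> leaves the density unchanged but flips the sign of the error
  \<open>X u\<^sub>1\<close> of \<open>g0\<close>; averaging both representations, the parallelogram law removes the cross term.\<close>
lemma bayes_estimator_optimal:
  fixes X :: "real^'n^'n" and Y :: "real^'p^'p" and G :: "real^'p^'n" and m :: "real^('n + 'p)"
  assumes X: "invertible X" and Y: "invertible Y"
    and g0: "g0 = (\<lambda>y. G *v (y - ypart m) + xpart m)"
    and g [measurable]: "g \<in> borel_measurable borel"
    and K: "K = blk_mat X (G ** Y) 0 Y ** transpose (blk_mat X (G ** Y) 0 Y)"
  shows "mse (gauss_pdf m K) g0 \<le> mse (gauss_pdf m K) g"
proof -
  \<comment> \<open>\<open>X\<close> enters \<open>K\<close> only through
    \<open>X ** transpose X\<close>, so \<open>s = 1\<close> and \<open>s = -1\<close> both yield a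
    root of \<open>K\<close>.\<close>
  define T where "T s = blk_mat (s *\<^sub>R X) (G ** Y) 0 Y" for s :: real
  have T: "invertible (T s)" "K = T s ** transpose (T s)" if "s\<^sup>2 = 1" for s
  proof -
    show KT: "K = T s ** transpose (T s)"
      using that by (simp add: K T_def transpose_blk_mat blk_mat_mult matrix_mult_scaleR transpose_scalar transpose_0
          power2_eq_square)
    have "T s ** blk_mat (s *\<^sub>R matrix_inv X) (- s *\<^sub>R (matrix_inv X ** G)) 0 (matrix_inv Y) = mat 1"
      using that by (simp add: T_def blk_mat_mult matrix_mult_scaleR matrix_mult_uminus matrix_mul_assoc
          invertible_inv X Y power2_eq_square)
        (simp add: invertible_inv Y blk_mat_1 flip: matrix_mul_assoc)
    then show "invertible (T s)" by (rule matrix_inv_eqI)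
  qed
  have [measurable]: "g0 \<in> borel_measurable borel"
    unfolding g0 by measurable
  define y where "y u = ypart m + Y *v ypart u" for u :: "real^('n + 'p)"
  \<comment> \<open>The deviation of a competitor from \<open>g0\<close>. It depends on
    \<open>u\<close> only through the y block, hence is the same for both signs of \<open>s\<close>,
    and it vanishes for \<open>g0\<close> itself.\<close>
  define b where "b g u = g0 (y u) - g (y u)" for g :: "real^'p \<Rightarrow> real^'n" and u :: "real^('n + 'p)"
  have mse: "mse (gauss_pdf m K) g = (\<integral>\<^sup>+ u. ennreal ((norm (s *\<^sub>R (X *v xpart u) + b g u))\<^sup>2) \<partial>std_gauss)"
    if "s\<^sup>2 = 1" "g \<in> borel_measurable borel" for s g
  proof -
    have [measurable]: "g \<in> borel_measurable borel" by fact
    have "xpart (m + T s *v u) - g (ypart (m + T s *v u)) = s *\<^sub>R (X *v xpart u) + b g u" for u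
      by (simp add: T_def xpart_add ypart_add xpart_blk_mat ypart_blk_mat b_def y_def g0
          matrix_vector_mul_assoc scaleR_matrix_vector_assoc)
    then show ?thesis
      unfolding mse_def T(2)[OF that(1)] by (subst nn_integral_gauss_pdf[OF T(1)[OF that(1)]]) simp_all
  qed
  have [measurable]: "y \<in> borel_measurable borel" "b g \<in> borel_measurable borel"
    unfolding y_def[abs_def] b_def[abs_def] by measurable
  have "2 * mse (gauss_pdf m K) g0 = (\<integral>\<^sup>+ u. 2 * ennreal ((norm (X *v xpart u))\<^sup>2)
      \<partial>(std_gauss :: (real^('n + 'p)) measure))"
    by (subst nn_integral_cmult) (simp_all add: mse[of 1] b_def)
  also have "\<dots> \<le> (\<integral>\<^sup>+ u. ennreal ((norm (1 *\<^sub>R (X *v xpart u) + b g u))\<^sup>2)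
      + ennreal ((norm ((- 1) *\<^sub>R (X *v xpart u) + b g u))\<^sup>2) \<partial>std_gauss)"
  proof (rule nn_integral_mono)
    fix u
    have "2 * (norm v)\<^sup>2 \<le> (norm (1 *\<^sub>R v + w))\<^sup>2 + (norm ((- 1) *\<^sub>R v + w))\<^sup>2" for v w :: "real^'n"
      by (simp add: power2_norm_eq_inner inner_add_left inner_add_right inner_diff_left inner_diff_right)
    then show "2 * ennreal ((norm (X *v xpart u))\<^sup>2) \<le> ennreal ((norm (1 *\<^sub>R (X *v xpart u) + b g u))\<^sup>2)
      + ennreal ((norm ((- 1) *\<^sub>R (X *v xpart u) + b g u))\<^sup>2)"
      by (metis ennreal_leI ennreal_mult' ennreal_numeral ennreal_plus zero_le_numeral zero_le_power2)
  qed
  also have "\<dots> = mse (gauss_pdf m K) g + mse (gauss_pdf m K) g"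
    using mse[of 1 g] mse[of "-1" g] g by (subst nn_integral_add) simp_all
  also have "\<dots> = 2 * mse (gauss_pdf m K) g" by (simp add: mult_2)
  finally show ?thesis
    by (simp add: ennreal_mult_le_mult_iff)
qed

text \<open>Positivity is inherited by compression: the block row \<open>[0 I]\<close> gives
  \<open>blk_yy K\<close>, and \<open>[I -G]\<close> gives the Schur complement. Multiplying
  \<open>K\<close> from the left by \<open>[I -G]\<close> makes the y block vanish, which says that
  the error is uncorrelated with y.\<close>

lemma blocks_of_pos_def:
  fixes K :: "real^('n::finite + 'p::finite)^('n + 'p)"
  assumes K: "pos_def K"
  defines "G \<equiv> blk_xy K ** matrix_inv (blk_yy K)"
  shows "pos_def (blk_yy K)" "G ** blk_yy K = blk_xy K" "blk_yy K ** transpose G = blk_yx K"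
    "pos_def (blk_xx K - G ** blk_yx K)"
    "blk_row (mat 1) (- G) ** K ** transpose (blk_row (mat 1) (- G)) = blk_xx K - G ** blk_yx K"
proof -
  have sym: "transpose K = K" using K by (simp add: pos_def_def)
  have Ksym: "K $ a $ b = K $ b $ a" for a b
    using arg_cong[OF sym, of "\<lambda>K. K $ a $ b"] by (simp add: transpose_def)
  have "blk_row 0 (mat 1 :: real^'p^'p) ** K ** transpose (blk_row 0 (mat 1)) = blk_yy K"
    by (subst (1) blk_mat_blks[of K, symmetric]) (simp add: blk_row_mult blk_row_mult_transpose transpose_mat transpose_0)
  moreover have "pos_def (blk_row 0 (mat 1 :: real^'p^'p) ** K ** transpose (blk_row 0 (mat 1)))"
  proof (rule pos_def_conj[OF K])
    fix v :: "real^'p" assume "transpose (blk_row (0 :: real^'n^'p) (mat 1)) *v v = 0"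
    from arg_cong[OF this, of ypart] show "v = 0"
      unfolding ypart_transpose_blk_row by (simp add: transpose_mat ypart_0)
  qed
  ultimately show yy: "pos_def (blk_yy K)" by simp
  obtain Y :: "real^'p^'p" where "blk_yy K = Y ** transpose Y" "invertible Y" using pos_def_sqrt[OF yy] by blast
  then have inv: "invertible (blk_yy K)" by (simp add: invertible_mult invertible_transpose)
  show Gyy: "G ** blk_yy K = blk_xy K"
    by (simp add: G_def invertible_inv[OF inv] flip: matrix_mul_assoc)
  have xy: "transpose (blk_xy K) = blk_yx K"
    using Ksym by (simp add: vec_eq_iff transpose_def blk_xy_def blk_yx_def)
  have "transpose (G ** blk_yy K) = blk_yy K ** transpose G"
    using yy by (simp add: matrix_transpose_mul pos_def_def)
  then show "blk_yy K ** transpose G = blk_yx K" by (simp add: Gyy xy)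
  show *: "blk_row (mat 1) (- G) ** K ** transpose (blk_row (mat 1) (- G)) = blk_xx K - G ** blk_yx K"
  proof -
    have "blk_row (mat 1) (- G) ** K = blk_row (blk_xx K - G ** blk_yx K) 0"
      by (subst (1) blk_mat_blks[of K, symmetric]) (simp add: blk_row_mult matrix_mult_uminus Gyy)
    then show ?thesis by (simp add: blk_row_mult_transpose transpose_mat transpose_0)
  qed
  have "pos_def (blk_row (mat 1) (- G) ** K ** transpose (blk_row (mat 1) (- G)))"
  proof (rule pos_def_conj[OF K])
    fix v :: "real^'n" assume "transpose (blk_row (mat 1) (- G)) *v v = 0"
    from arg_cong[OF this, of xpart] show "v = 0"
      unfolding xpart_transpose_blk_row by (simp add: transpose_mat xpart_0)
  qed
  then show "pos_def (blk_xx K - G ** blk_yx K)" by (simp only: *)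
qed

section \<open>The saddle point and the least favorable density\<close>

theorem theorem1:
  fixes \<tau> c :: real
    and m :: "real^('n::finite + 'p::finite)"
    and K :: "real^('n + 'p)^('n + 'p)"
  assumes "0 \<le> \<tau>" and "\<tau> \<le> 1" and "c > 0" and "pos_def K"
  defines "B \<equiv> ball_tau \<tau> c m K"
    and "G \<equiv> estimators (ball_tau \<tau> c m K)"
    and "g0 \<equiv> (\<lambda>y. (blk_xy K ** matrix_inv (blk_yy K)) *v (y - ypart m) + xpart m)"
    and "S \<equiv> blk_xy K ** matrix_inv (blk_yy K) ** blk_yx K"
    and "P \<equiv> blk_xx K - blk_xy K ** matrix_inv (blk_yy K) ** blk_yx K"
  shows "g0 \<in> G
    \<and> (\<forall>g\<in>G. (SUP f\<in>B. mse f g0) \<le> (SUP f\<in>B. mse f g))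
    \<and> (\<exists>lam Kxt. (1 - \<tau>) * spec_norm P < lam
         \<and> pos_def (replace_xx Kxt K)
         \<and> gauss_pdf m (replace_xx Kxt K) \<in> B
         \<and> tau_div \<tau> m (replace_xx Kxt K) m K = ereal c
         \<and> (\<forall>f\<in>B. mse f g0 \<le> mse (gauss_pdf m (replace_xx Kxt K)) g0)
         \<and> (\<forall>g\<in>G. mse (gauss_pdf m (replace_xx Kxt K)) g0 \<le> mse (gauss_pdf m (replace_xx Kxt K)) g)
         \<and> integrable lborel (\<lambda>z. gauss_pdf m K z *\<^sub>R (xpart z - g0 (ypart z)))
         \<and> (\<integral>z. gauss_pdf m K z *\<^sub>R (xpart z - g0 (ypart z)) \<partial>lborel) = 0
         \<and> (\<integral>z. gauss_pdf m K z *\<^sub>R outer (xpart z - g0 (ypart z)) \<partial>lborel) = P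
         \<and> integrable lborel (\<lambda>z. gauss_pdf m (replace_xx Kxt K) z *\<^sub>R (xpart z - g0 (ypart z)))
         \<and> (\<integral>z. gauss_pdf m (replace_xx Kxt K) z *\<^sub>R (xpart z - g0 (ypart z)) \<partial>lborel) = 0
         \<and> (\<integral>z. gauss_pdf m (replace_xx Kxt K) z *\<^sub>R outer (xpart z - g0 (ypart z)) \<partial>lborel) = Kxt - S
         \<and> (\<forall>L. P = L ** transpose L \<longrightarrow> Kxt - S = Ptilde_formula \<tau> lam L)
         \<and> (\<forall>lam' L. (1 - \<tau>) * spec_norm P < lam' \<longrightarrow> P = L ** transpose L \<longrightarrow>
              tau_div \<tau> m (replace_xx (Ptilde_formula \<tau> lam' L + S) K) m K = ereal c \<longrightarrow> lam' = lam))"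
proof -
  note \<tau> = assms(1,2) and c = assms(3) and K = assms(4)
  define Gm where "Gm = blk_xy K ** matrix_inv (blk_yy K)"
  note blocks = blocks_of_pos_def[OF K, folded Gm_def]
  have S: "S = Gm ** blk_yx K" and P: "P = blk_xx K - Gm ** blk_yx K"
    and g0: "g0 = (\<lambda>y. Gm *v (y - ypart m) + xpart m)"
    by (simp_all add: S_def P_def g0_def Gm_def)
  obtain U p where U: "orthogonal_matrix U" and Pd: "P = U ** diag_mat p ** transpose U" and p: "\<And>i. p $ i > 0"
    using pos_def_diagonalisation[OF blocks(4)] unfolding P by blast
  have UU: "transpose U ** U = mat 1" using U by (simp add: orthogonal_matrix_def)
  have Ui: "invertible U" using UU invertible_left_inverse by blast
  obtain Y :: "real^'p^'p" where Y: "blk_yy K = Y ** transpose Y" "invertible Y"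
    using pos_def_sqrt[OF blocks(1)] by blast
  \<comment> \<open>One eigenbasis \<open>U\<close> serves the nominal and the perturbed error
    covariance. Unlike the symmetric root, this one makes \<open>transpose (Xf d) ** Xf d\<close>
    diagonal, and the roots for different \<open>d\<close> differ by a diagonal factor on the
    right.\<close>
  define Xf where "Xf d = U ** diag_mat (\<chi> i. sqrt (d $ i))" for d :: "real^'n"
  have Xf: "Xf d ** transpose (Xf d) = U ** diag_mat d ** transpose U" "invertible (Xf d)"
    if d: "\<And>i. d $ i > 0" for d
  proof -
    have "Xf d ** transpose (Xf d)
        = U ** (diag_mat (\<chi> i. sqrt (d $ i)) ** diag_mat (\<chi> i. sqrt (d $ i))) ** transpose U"
      by (simp add: Xf_def matrix_transpose_mul transpose_diag_mat matrix_mul_assoc)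
    then show "Xf d ** transpose (Xf d) = U ** diag_mat d ** transpose U"
      by (simp add: diag_mat_mult d less_imp_le)
    have "(\<Prod>i\<in>UNIV. sqrt (d $ i)) \<noteq> 0" using d by (simp add: less_imp_neq[symmetric])
    then show "invertible (Xf d)" using Ui
      by (simp add: Xf_def invertible_det_nz det_mul det_diag_mat)
  qed
  define C where "C = blk_row (mat 1) (- Gm)"
  have negv: "- A *v v = - (A *v v)" for A :: "real^'p^'n" and v
    using scaleR_matrix_vector_assoc[of "-1" A v] by simp
  have err: "xpart z - g0 (ypart z) = C *v (z - m)" for z
    by (simp add: C_def blk_row_vec g0 xpart_diff ypart_diff negv)

  \<comment> \<open>The second block column does not depend on \<open>d\<close>, so varying
    \<open>d\<close> moves only the xx block of \<open>Tf d ** transpose (Tf d)\<close>.\<close>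
  define Tf where "Tf d = blk_mat (Xf d) (Gm ** Y) 0 Y" for d
  have Kf: "Tf d ** transpose (Tf d) = replace_xx (U ** diag_mat d ** transpose U + S) K"
    if d: "\<And>i. d $ i > 0" for d
  proof -
    have "Gm ** Y ** transpose Y = blk_xy K"
      using blocks(2) by (simp add: Y matrix_mul_assoc)
    moreover have "Y ** transpose (Gm ** Y) = blk_yx K"
      using blocks(3) by (simp add: Y matrix_transpose_mul matrix_mul_assoc)
    moreover have "Gm ** Y ** transpose (Gm ** Y) = S"
      using blocks(3) unfolding S by (simp add: Y matrix_transpose_mul flip: matrix_mul_assoc)
    ultimately show ?thesis
      by (simp add: Tf_def transpose_blk_mat blk_mat_mult transpose_0 Xf[OF d] replace_xx_eq Y)
  qed
  have Tf_inv: "invertible (Tf d)" if d: "\<And>i. d $ i > 0" for d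
  proof (rule matrix_inv_eqI)
    let ?Xi = "matrix_inv (Xf d)"
    have "Tf d ** blk_mat ?Xi (- (?Xi ** Gm)) 0 (matrix_inv Y) = blk_mat (mat 1) 0 0 (mat 1)"
    proof -
      have "Xf d ** - (?Xi ** Gm) = - Gm"
        by (simp add: matrix_mult_uminus matrix_mul_assoc invertible_inv Xf[OF d])
      moreover have "Gm ** Y ** matrix_inv Y = Gm"
        by (simp add: invertible_inv Y flip: matrix_mul_assoc)
      ultimately show ?thesis by (simp add: Tf_def blk_mat_mult invertible_inv Xf[OF d] Y)
    qed
    also have "\<dots> = mat 1" by (rule blk_mat_1)
    finally show "Tf d ** blk_mat ?Xi (- (?Xi ** Gm)) 0 (matrix_inv Y) = mat 1" .
  qed
  define T where "T = Tf p"
  have T: "invertible T" unfolding T_def by (rule Tf_inv[OF p])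
  have KT: "K = T ** transpose T"
    using Kf[OF p] by (simp add: T_def S P Pd[symmetric] replace_xx_eq blk_mat_blks)
  define w :: "real^('n + 'p)" where "w = blk_vec p 0"
  have CT: "C ** Tf d = blk_row (Xf d) 0" for d
    by (simp add: C_def Tf_def blk_row_mult matrix_mult_uminus)
  have ww: "transpose (C ** T) ** (C ** T) = diag_mat w"
  proof -
    have "transpose (Xf p) ** Xf p
        = diag_mat (\<chi> i. sqrt (p $ i)) ** (transpose U ** U) ** diag_mat (\<chi> i. sqrt (p $ i))"
      by (simp add: Xf_def matrix_transpose_mul transpose_diag_mat matrix_mul_assoc)
    then have "transpose (Xf p) ** Xf p = diag_mat p"
      by (simp add: UU diag_mat_mult p less_imp_le)
    moreover have "transpose (blk_row X (0 :: real^'p^'n)) ** blk_row X 0 = blk_mat (transpose X ** X) 0 0 0" for X :: "real^'n^'n"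
      by (simp add: vec_sum_eq_iff matrix_matrix_mult_def transpose_def)
    moreover have "diag_mat (0 :: real^'p) = 0" by (simp add: vec_eq_iff diag_mat_def)
    ultimately show ?thesis unfolding T_def CT w_def by (simp flip: blk_mat_diag)
  qed
  \<comment> \<open>In the coordinates of \<open>T\<close> the perturbation is diagonal: its
    relative eigenvalues are \<open>s\<close> on the x directions and 1 on the y directions, so
    \<open>tau_div_diag\<close> reads off the divergence.\<close>
  have KfT: "replace_xx (U ** diag_mat (\<chi> i. p $ i * s $ i) ** transpose U + S) K
      = T ** diag_mat (blk_vec s (\<chi> j. 1)) ** transpose T" if s: "\<And>i. s $ i > 0" for s :: "real^'n"
  proof -
    have ps: "(\<chi> i. p $ i * s $ i) $ i > 0" for i using p s by simp
    have "Tf (\<chi> i. p $ i * s $ i) = T ** diag_mat (blk_vec (\<chi> i. sqrt (s $ i)) (\<chi> j. 1))"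
    proof -
      have "Xf (\<chi> i. p $ i * s $ i) = Xf p ** diag_mat (\<chi> i. sqrt (s $ i))"
        by (simp add: Xf_def real_sqrt_mult diag_mat_mult flip: matrix_mul_assoc)
      then show ?thesis
        by (simp add: T_def Tf_def blk_mat_mult diag_mat_1 flip: blk_mat_diag)
    qed
    then have "replace_xx (U ** diag_mat (\<chi> i. p $ i * s $ i) ** transpose U + S) K
      = T ** (diag_mat (blk_vec (\<chi> i. sqrt (s $ i)) (\<chi> j. 1)) ** diag_mat (blk_vec (\<chi> i. sqrt (s $ i)) (\<chi> j. 1))) ** transpose T"
      by (simp add: Kf[OF ps, symmetric] matrix_transpose_mul transpose_diag_mat matrix_mul_assoc)
    also have "diag_mat (blk_vec (\<chi> i. sqrt (s $ i)) (\<chi> j. 1)) ** diag_mat (blk_vec (\<chi> i. sqrt (s $ i)) (\<chi> j. 1))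
      = diag_mat (blk_vec s (\<chi> j. 1))"
      unfolding diag_mat_mult by (rule arg_cong[of _ _ diag_mat]) (simp add: vec_sum_eq_iff s less_imp_le)
    finally show ?thesis .
  qed

  obtain lam where lam: "lam > 0" "\<And>i. (1 - \<tau>) * p $ i < lam"
    and sum_c: "(\<Sum>i\<in>UNIV. tau_fun \<tau> (tau_inv \<tau> (p $ i / lam))) = c"
    using tau_multiplier_exists[OF \<tau> p c] by blast
  define sv where "sv lam = (\<chi> i. tau_inv \<tau> (p $ i / lam))" for lam
  have sv: "sv l $ i > 0" if "l > 0" "\<And>i. (1 - \<tau>) * p $ i < l" for l i
    unfolding sv_def using that by (simp add: tau_inv_pos field_simps)
  define Ptf where "Ptf lam = U ** diag_mat (\<chi> i. p $ i * sv lam $ i) ** transpose U" for lam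
  \<comment> \<open>Kept for a general multiplier \<open>l\<close>: at \<open>lam\<close> it shows
    that the constraint is active, and at a rival multiplier it gives uniqueness. The y block
    contributes \<open>tau_fun \<tau> 1 = 0\<close>.\<close>
  have td: "tau_div \<tau> m (replace_xx (Ptf l + S) K) m K = ereal (\<Sum>i\<in>UNIV. tau_fun \<tau> (tau_inv \<tau> (p $ i / l)))"
    if "l > 0" "\<And>i. (1 - \<tau>) * p $ i < l" for l
    unfolding Ptf_def KfT[OF sv[OF that]] unfolding KT tau_div_diag[OF \<tau> T]
    using \<tau> by (simp add: sum_UNIV_Plus sv_def)
  have Ptilde: "Ptilde_formula \<tau> l L = Ptf l" if "P = L ** transpose L" for l L
  proof -
    have "pos_def (L ** transpose L)" using blocks(4) that unfolding P by simp
    from mult_transpose_invertible[OF this] show ?thesis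
      using Ptilde_formula_diagonalisation[OF U _ _ \<tau>(2), of L p l] that Pd
      by (simp add: Ptf_def sv_def)
  qed
  define Kxt where "Kxt = Ptf lam + S"
  define Ko where "Ko = replace_xx Kxt K"
  have svl: "sv lam $ i > 0" for i by (rule sv[OF lam])
  define d where "d = (\<chi> i. p $ i * sv lam $ i)"
  have d: "d $ i > 0" for i using p svl by (simp add: d_def)
  have Ko_Tf: "Ko = Tf d ** transpose (Tf d)" unfolding Kf[OF d] by (simp add: Ko_def Kxt_def Ptf_def d_def)
  have Ko_pos: "pos_def Ko" unfolding Ko_Tf by (rule pos_def_mult_transpose[OF Tf_inv[OF d]])
  have td_Ko: "tau_div \<tau> m Ko m K = ereal c"
    unfolding Ko_def Kxt_def td[OF lam] sum_c ..
  have Ko_B: "gauss_pdf m Ko \<in> B" unfolding B_def ball_tau_def using Ko_pos td_Ko by force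

  have mse_g0: "mse (gauss_pdf mt Kt) g0
      = ennreal ((C *v (mt - m)) \<bullet> (C *v (mt - m)) + trace (C ** Kt ** transpose C))"
    if "pos_def Kt" for mt Kt
  proof -
    \<comment> \<open>Recentring the affine error at the perturbed mean \<open>mt\<close> separates
      its bias from its fluctuation.\<close>
    have "xpart z - g0 (ypart z) = C *v (mt - m) + C *v (z - mt)" for z
      by (simp add: err flip: matrix_vector_right_distrib)
    then show ?thesis unfolding mse_def by (simp add: gauss_pdf_norm_square[OF that])
  qed
  have CKC: "C ** (Tf d ** transpose (Tf d)) ** transpose C = U ** diag_mat d ** transpose U"
    if "\<And>i. d $ i > 0" for d
  proof -
    have "C ** (Tf d ** transpose (Tf d)) ** transpose C = (C ** Tf d) ** transpose (C ** Tf d)"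
      by (simp add: matrix_transpose_mul matrix_mul_assoc)
    then show ?thesis by (simp add: CT blk_row_mult_transpose Xf[OF that])
  qed
  have trd: "trace (U ** diag_mat d ** transpose U) = (\<Sum>i\<in>UNIV. d $ i)"
    using trace_conj[OF Ui, of "diag_mat d"] matrix_inv_eqI(1)[of U "transpose U"] U
    by (simp add: orthogonal_matrix_def trace_diag_mat)
  have mse_Ko: "mse (gauss_pdf m Ko) g0 = ennreal (\<Sum>i\<in>UNIV. d $ i)"
    unfolding mse_g0[OF Ko_pos] by (simp add: Ko_Tf CKC[OF d] trd)
  have worst: "mse f g0 \<le> mse (gauss_pdf m Ko) g0" if f_in: "f \<in> B" for f
  proof -
    obtain mt Kt where f: "f = gauss_pdf mt Kt" and Kt: "pos_def Kt" and div: "tau_div \<tau> mt Kt m K \<le> ereal c"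
      using f_in unfolding B_def ball_tau_def by blast
    \<comment> \<open>On the y directions the weight is 0 and the bound reduces to
      \<open>lam > 0\<close>.\<close>
    have lamw: "(1 - \<tau>) * w $ a < lam" for a
      using lam by (cases a) (simp_all add: w_def)
    have "(\<Sum>a\<in>UNIV. tau_fun \<tau> (tau_inv \<tau> (w $ a / lam))) = c"
      using \<tau> by (simp add: sum_UNIV_Plus w_def sum_c)
    then have "(C *v (mt - m)) \<bullet> (C *v (mt - m)) + trace (C ** Kt ** transpose C)
        \<le> (\<Sum>a\<in>UNIV. w $ a * tau_inv \<tau> (w $ a / lam))"
      using div unfolding KT by (intro tau_div_saddle_bound[OF \<tau> T Kt ww lam(1) lamw]) simp
    also have "\<dots> = (\<Sum>i\<in>UNIV. d $ i)" by (simp add: sum_UNIV_Plus w_def d_def sv_def)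
    finally show ?thesis unfolding f mse_g0[OF Kt] mse_Ko by (rule ennreal_leI)
  qed
  have bayes: "mse (gauss_pdf m Ko) g0 \<le> mse (gauss_pdf m Ko) g" if "g \<in> G" for g
    using that bayes_estimator_optimal[OF Xf(2)[OF d] Y(2) g0 _ Ko_Tf[unfolded Tf_def]]
    by (auto simp: G_def estimators_def)
  have "g0 \<in> G"
    unfolding G_def estimators_def
  proof (intro CollectI conjI ballI)
    show "g0 \<in> borel_measurable borel" unfolding g0 by measurable
    fix f assume "f \<in> ball_tau \<tau> c m K"
    then obtain mt Kt where f: "f = gauss_pdf mt Kt" and Kt: "pos_def Kt"
      unfolding ball_tau_def by blast
    \<comment> \<open>The estimator is expanded around the mean \<open>mt\<close> of
      \<open>f\<close> rather than around \<open>m\<close>, so that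
      \<open>gauss_pdf_norm_square\<close> applies to each member of the ball.\<close>
    define a where "a = g0 (ypart mt)"
    have g0_affine: "g0 (ypart z) = a + blk_row 0 Gm *v (z - mt)" for z
      by (simp add: a_def g0 blk_row_vec ypart_diff matrix_vector_mult_diff_distrib)
    show "(\<integral>\<^sup>+ z. ennreal (f z) * ennreal ((norm (g0 (ypart z)))\<^sup>2) \<partial>lborel) < \<infinity>"
      unfolding f g0_affine gauss_pdf_norm_square[OF Kt] by simp
  qed
  have minimax: "(SUP f\<in>B. mse f g0) \<le> (SUP f\<in>B. mse f g)" if "g \<in> G" for g
  proof -
    have "(SUP f\<in>B. mse f g0) \<le> mse (gauss_pdf m Ko) g0" by (rule SUP_least) (rule worst)
    also have "\<dots> \<le> mse (gauss_pdf m Ko) g" by (rule bayes[OF that])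
    also have "\<dots> \<le> (SUP f\<in>B. mse f g)" by (rule SUP_upper[OF Ko_B])
    finally show ?thesis .
  qed
  have CKP: "C ** K ** transpose C = P" using blocks(5) by (simp add: C_def P)
  have CKoP: "C ** Ko ** transpose C = Kxt - S"
    by (simp add: Ko_Tf CKC[OF d]) (simp add: Kxt_def Ptf_def d_def)
  have moments: "integrable lborel (\<lambda>z. gauss_pdf m Kt z *\<^sub>R (xpart z - g0 (ypart z)))"
      "(\<integral>z. gauss_pdf m Kt z *\<^sub>R (xpart z - g0 (ypart z)) \<partial>lborel) = 0"
      "(\<integral>z. gauss_pdf m Kt z *\<^sub>R outer (xpart z - g0 (ypart z)) \<partial>lborel) = C ** Kt ** transpose C"
    if "pos_def Kt" for Kt
    using gauss_pdf_mean[OF that, of m C] gauss_pdf_covariance[OF that, of m C]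
    unfolding err has_bochner_integral_iff by blast+
  \<comment> \<open>The spectral norm is bounded by a single eigenvalue \<open>p $ k\<close>, so the
    strict eigenvalue bounds on \<open>lam\<close> carry over.\<close>
  have spec: "(1 - \<tau>) * spec_norm P < lam"
  proof -
    obtain k where "spec_norm P \<le> p $ k" using spec_norm_diagonalisation(2)[OF U Pd p] by blast
    then have "(1 - \<tau>) * spec_norm P \<le> (1 - \<tau>) * p $ k" using \<tau> by (intro mult_left_mono) auto
    then show ?thesis using lam(2)[of k] by linarith
  qed
  have unique: "lam' = lam"
    if lam': "(1 - \<tau>) * spec_norm P < lam'" and L: "P = L ** transpose L"
      and div: "tau_div \<tau> m (replace_xx (Ptilde_formula \<tau> lam' L + S) K) m K = ereal c" for lam' L
  proof -
    note le = spec_norm_diagonalisation(1)[OF U Pd p]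
    have 1: "(1 - \<tau>) * p $ i < lam'" for i
      using mult_left_mono[OF le[of i], of "1 - \<tau>"] \<tau> lam' by simp
    \<comment> \<open>Positivity of \<open>lam'\<close> is derived: any eigenvalue, here the one at
      an arbitrary index, is positive and bounds the spectral norm from below.\<close>
    have "0 \<le> (1 - \<tau>) * spec_norm P"
      using \<tau> le[of undefined] p[of undefined] by simp
    then have 2: "lam' > 0" using lam' by linarith
    have "(\<Sum>i\<in>UNIV. tau_fun \<tau> (tau_inv \<tau> (p $ i / lam'))) = c"
      using div unfolding Ptilde[OF L] td[OF 2 1] by simp
    then show ?thesis
      by (intro tau_multiplier_unique[OF \<tau> p lam 2 1]) (simp add: sum_c)
  qed
  show ?thesis
  proof (intro conjI exI[of _ lam] exI[of _ Kxt] ballI allI impI; (fold Ko_def)?)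
    show "Kxt - S = Ptilde_formula \<tau> lam L" if "P = L ** transpose L" for L
      by (simp add: Ptilde[OF that] Kxt_def)
  qed (fact \<open>g0 \<in> G\<close> minimax spec Ko_pos Ko_B td_Ko worst bayes moments[OF K] moments[OF Ko_pos]
      moments(3)[OF K, unfolded CKP] moments(3)[OF Ko_pos, unfolded CKoP] | (rule unique, assumption+))+
qed

end
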